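(* Let $(\mathcal{X},p(y_1,y_2|x),\mathcal{Y}_1\times\mathcal{Y}_2)$ be any discrete memoryless broadcast channel, with cooperating receivers having noiseless conference links of finite capacities $C_{12}$ (from receiver 1 to receiver 2) and $C_{21}$ (from receiver 2 to receiver 1). Then, for sending a common message to both receivers, any rate $R$ satisfying $$R\le\sup_{p(x)}\Big[\max\big\{R^{12}(p(x)),\,R^{21}(p(x))\big\}\Big],$$ $$R^{12}(p(x))\triangleq\min\Big(I(X;Y_1)+C_{21},\; I(X;Y_2)-I(\hat V;Y_1|Y_2,X)+\min\big(C_{12},\,H(\hat V|Y_2)-H(\hat V|Y_1)\big)\Big),$$ $$R^{21}(p(x))\triangleq\min\Big(I(X;Y_2)+C_{12},\; I(X;Y_1)-I(\hat U;Y_2|Y_1,X)+\min\big(C_{21},\,H(\hat U|Y_1)-H(\hat U|Y_2)\big)\Big),$$ for some joint distribution $p(x,y_1,y_2,\hat u,\hat v)=p(x)p(y_1,y_2|x)p(\hat u|y_2)p(\hat v|y_1)$, is achievable, with $\|\hat{\mathcal{U}}\|\le\|\mathcal{Y}_2\|+1$ and $\|\hat{\mathcal{V}}\|\le\|\mathcal{Y}_1\|+1$, and with the appropriate $C_{12}\ge I(\hat V;Y_1|Y_2,X)$ (for $R^{12}$) or $C_{21}\ge I(\hat U;Y_2|Y_1,X)$ (for $R^{21}$), namely the condition on the link used for the first cooperation step. (That is, the supremum is over input distributions $p(x)$, together with the choices of $p(\hat u|y_2)$ and $p(\hat v|y_1)$, and $R^{12}$, respectively $R^{21}$, enters the maximum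 only when its condition holds under the corresponding joint distribution.)
   Context: All alphabets are finite, $\|\mathcal{A}\|$ denotes the cardinality of a finite set $\mathcal{A}$, and entropies and mutual informations are in bits; $\hat{\mathcal{U}},\hat{\mathcal{V}}$ are the ranges of $\hat U,\hat V$. Rates and link capacities are nonnegative reals. A discrete memoryless broadcast channel with input alphabet $\mathcal{X}$, output alphabets $\mathcal{Y}_1,\mathcal{Y}_2$ and transition function $p(y_1,y_2|x)$ satisfies $p(y_1^n,y_2^n|x^n)=\prod_{i=1}^n p(y_{1,i},y_{2,i}|x_i)$; receiver $k$ observes $Y_k^n$. Conference: after reception each receiver sends at most one message to the other. The conference message sets are $\mathcal{W}_{12}=\{1,\dots,2^{nR_{12}}\}$ and $\mathcal{W}_{21}=\{1,\dots,2^{nR_{21}}\}$ with $R_{12}\le C_{12}$, $R_{21}\le C_{21}$. The message $W_{12}\in\mathcal{W}_{12}$ sent by receiver 1 is a function of $Y_1^n$ and of any message already received from receiver 2, and $W_{21}\in\mathcal{W}_{21}$ sent by receiver 2 is a function of $Y_2^n$ and of any message already received from receiver 1; i.e. either $W_{12}=h_{12}(Y_1^n)$ and $W_{21}=h_{21}(Y_2^n,W_{12})$, or $W_{21}=h_{21}(Y_2^n)$ and $W_{12}=h_{12}(Y_1^n,W_{21})$. The rates $R^{12}$ and $R^{21}$ correspond to a two-step conference in which the first cooperation step is from receiver 1 to receiver 2, respectively from receiver 2 to receiver 1. A code of block length $n$ and rate $R$ for a common message consists of a message set $\mathcal{W}=\{1,2,\dots,2^{nR}\}$, an encoder $f:\mathcal{W}\to\mathcal{X}^n$,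 a conference as just described, and decoders $g_1:\mathcal{W}_{21}\times\mathcal{Y}_1^n\to\mathcal{W}$, $g_2:\mathcal{W}_{12}\times\mathcal{Y}_2^n\to\mathcal{W}$. The message $W$ is uniform on $\mathcal{W}$, $X^n=f(W)$ is sent, and $P_e^{(n)}=\Pr(g_1(W_{21},Y_1^n)\ne W\text{ or }g_2(W_{12},Y_2^n)\ne W)$. A rate $R$ is achievable if there exists a sequence of codes of rate $R$ with $P_e^{(n)}\to0$ as $n\to\infty$.
   Formalization: At R equal to the supremum, codes of rate exactly R need not exist (e.g. a noisy binary symmetric channel with Y1=Y2 and no links, used at capacity); there the theorem gives codes with rates converging to R and vanishing error; for R below the supremum, rate is exactly R. *)

theory Defs
  imports "HOL-Probability.Probability"
begin

section \<open>Single-letter quantities\<close>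

text \<open>
  Auxiliary letters are encoded as natural numbers.  A kernel out of the finite alphabet \<open>'a\<close>
  whose output alphabet has at most \<open>\<parallel>'a\<parallel> + 1\<close> letters:
\<close>

definition test_channels :: "('a::finite \<Rightarrow> nat pmf) set" where
  "test_channels =
     {q. \<exists>S. finite S \<and> card S \<le> CARD('a) + 1 \<and> (\<forall>a. set_pmf (q a) \<subseteq> S)}"

text \<open>The order of the components is \<open>(x, y1, y2, u, v)\<close>: \<open>u\<close> is drawn from \<open>y2\<close> and \<open>v\<close> from \<open>y1\<close>.\<close>

type_synonym ('x, 'y1, 'y2) letters = "'x \<times> 'y1 \<times> 'y2 \<times> nat \<times> nat"

definition joint_pmf ::
  "('x \<Rightarrow> ('y1 \<times> 'y2) pmf) \<Rightarrow> 'x pmf \<Rightarrow> ('y2 \<Rightarrow> nat pmf) \<Rightarrow> ('y1 \<Rightarrow> nat pmf) \<Rightarrow> ('x, 'y1, 'y2) letters pmf"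
where
  "joint_pmf W p qu qv =
     bind_pmf p (\<lambda>x. bind_pmf (W x) (\<lambda>(y1, y2). bind_pmf (qu y2) (\<lambda>u. bind_pmf (qv y1) (\<lambda>v.
       return_pmf (x, y1, y2, u, v)))))"

definition rvX :: "('x, 'y1, 'y2) letters \<Rightarrow> 'x" where "rvX = (\<lambda>(x, y1, y2, u, v). x)"
definition rvY1 :: "('x, 'y1, 'y2) letters \<Rightarrow> 'y1" where "rvY1 = (\<lambda>(x, y1, y2, u, v). y1)"
definition rvY2 :: "('x, 'y1, 'y2) letters \<Rightarrow> 'y2" where "rvY2 = (\<lambda>(x, y1, y2, u, v). y2)"
definition rvU :: "('x, 'y1, 'y2) letters \<Rightarrow> nat" where "rvU = (\<lambda>(x, y1, y2, u, v). u)"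
definition rvV :: "('x, 'y1, 'y2) letters \<Rightarrow> nat" where "rvV = (\<lambda>(x, y1, y2, u, v). v)"

text \<open>Information measures in bits, for discrete random variables on a discrete distribution.\<close>

definition mut_info :: "'w pmf \<Rightarrow> ('w \<Rightarrow> 'a) \<Rightarrow> ('w \<Rightarrow> 'b) \<Rightarrow> real" where
  "mut_info P A B =
     prob_space.mutual_information (measure_pmf P) 2 (count_space UNIV) (count_space UNIV) A B"

definition cond_mut_info :: "'w pmf \<Rightarrow> ('w \<Rightarrow> 'a) \<Rightarrow> ('w \<Rightarrow> 'b) \<Rightarrow> ('w \<Rightarrow> 'c) \<Rightarrow> real" where
  "cond_mut_info P A B C =
     prob_space.conditional_mutual_information (measure_pmf P) 2
       (count_space UNIV) (count_space UNIV) (count_space UNIV) A B C"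

definition cond_entropy :: "'w pmf \<Rightarrow> ('w \<Rightarrow> 'a) \<Rightarrow> ('w \<Rightarrow> 'b) \<Rightarrow> real" where
  "cond_entropy P A B =
     prob_space.conditional_entropy (measure_pmf P) 2 (count_space UNIV) (count_space UNIV) A B"

definition first_link_12 :: "('x, 'y1, 'y2) letters pmf \<Rightarrow> real" where
  "first_link_12 P = cond_mut_info P rvV rvY1 (\<lambda>\<omega>. (rvY2 \<omega>, rvX \<omega>))"

definition first_link_21 :: "('x, 'y1, 'y2) letters pmf \<Rightarrow> real" where
  "first_link_21 P = cond_mut_info P rvU rvY2 (\<lambda>\<omega>. (rvY1 \<omega>, rvX \<omega>))"

definition rate_12 :: "real \<Rightarrow> real \<Rightarrow> ('x, 'y1, 'y2) letters pmf \<Rightarrow> real" where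
  "rate_12 C12 C21 P =
     min (mut_info P rvX rvY1 + C21)
         (mut_info P rvX rvY2 - first_link_12 P
            + min C12 (cond_entropy P rvV rvY2 - cond_entropy P rvV rvY1))"

definition rate_21 :: "real \<Rightarrow> real \<Rightarrow> ('x, 'y1, 'y2) letters pmf \<Rightarrow> real" where
  "rate_21 C12 C21 P =
     min (mut_info P rvX rvY2 + C12)
         (mut_info P rvX rvY1 - first_link_21 P
            + min C21 (cond_entropy P rvU rvY1 - cond_entropy P rvU rvY2))"

text \<open>
  A rate enters the maximum only under its link condition; \<open>-\<infinity>\<close> stands for an excluded term.
  Constant auxiliaries make both conditions true, so the supremum is never \<open>-\<infinity>\<close>.
\<close>

definition admitted_rate :: "real \<Rightarrow> real \<Rightarrow> ('x, 'y1, 'y2) letters pmf \<Rightarrow> ereal" where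
  "admitted_rate C12 C21 P =
     max (if C12 \<ge> first_link_12 P then ereal (rate_12 C12 C21 P) else -\<infinity>)
         (if C21 \<ge> first_link_21 P then ereal (rate_21 C12 C21 P) else -\<infinity>)"

definition rate_bound ::
  "('x::finite \<Rightarrow> ('y1::finite \<times> 'y2::finite) pmf) \<Rightarrow> real \<Rightarrow> real \<Rightarrow> ereal" where
  "rate_bound W C12 C21 =
     (SUP (p, qu, qv) \<in> UNIV \<times> test_channels \<times> test_channels.
        admitted_rate C12 C21 (joint_pmf W p qu qv))"


section \<open>Block codes with conferencing receivers\<close>

text \<open>Words of length \<open>n\<close> are extensional functions on \<open>{..<n}\<close>.\<close>

definition words :: "nat \<Rightarrow> (nat \<Rightarrow> 'a) set" where
  "words n = ({..<n} \<rightarrow>\<^sub>E UNIV)"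

text \<open>The set \<open>{1, \<dots>, 2^(n r)}\<close>, where \<open>2^(n r)\<close> is rounded down to an integer.\<close>

definition messages :: "nat \<Rightarrow> real \<Rightarrow> nat set" where
  "messages n r = {1..nat \<lfloor>2 powr (real n * r)\<rfloor>}"

definition channel_block ::
  "('x \<Rightarrow> ('y1 \<times> 'y2) pmf) \<Rightarrow> nat \<Rightarrow> (nat \<Rightarrow> 'x) \<Rightarrow> ((nat \<Rightarrow> 'y1) \<times> (nat \<Rightarrow> 'y2)) pmf"
where
  "channel_block W n x =
     map_pmf (\<lambda>y. (restrict (\<lambda>i. fst (y i)) {..<n}, restrict (\<lambda>i. snd (y i)) {..<n}))
       (Pi_pmf {..<n} undefined (\<lambda>i. W (x i)))"

lemma pmf_channel_block:
  assumes "y1 \<in> words n" "y2 \<in> words n"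
  shows "pmf (channel_block W n x) (y1, y2) = (\<Prod>i<n. pmf (W (x i)) (y1 i, y2 i))"
proof -
  let ?g = "\<lambda>y. (restrict (\<lambda>i. fst (y i)) {..<n}, restrict (\<lambda>i. snd (y i)) {..<n})"
  let ?P = "Pi_pmf {..<n} undefined (\<lambda>i. W (x i))"
  let ?z = "\<lambda>i. if i < n then (y1 i, y2 i) else undefined"
  have z: "?g ?z = (y1, y2)"
    using assms by (auto simp: words_def fun_eq_iff restrict_def PiE_def extensional_def)
  have uniq: "y = ?z" if "y \<in> set_pmf ?P" "?g y = (y1, y2)" for y
  proof
    fix i
    show "y i = ?z i"
    proof (cases "i < n")
      case True
      have "fst (y i) = y1 i" "snd (y i) = y2 i"
        using that(2) True by (auto simp: restrict_def dest!: fun_cong[of _ _ i])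
      with True show ?thesis by (simp add: prod_eq_iff)
    next
      case False
      with that(1) show ?thesis using set_Pi_pmf_subset[of "{..<n}" undefined "\<lambda>i. W (x i)"] by auto
    qed
  qed
  have "pmf (channel_block W n x) (y1, y2) = measure_pmf.prob ?P (?g -` {(y1, y2)})"
    by (simp add: channel_block_def pmf_map)
  also have "\<dots> = measure_pmf.prob ?P {?z}"
    by (rule measure_eq_AE) (use uniq z in \<open>auto simp: AE_measure_pmf_iff\<close>)
  also have "\<dots> = (\<Prod>i<n. pmf (W (x i)) (y1 i, y2 i))"
    by (simp add: measure_pmf_single pmf_Pi)
  finally show ?thesis .
qed

text \<open>
  \<open>First12 h12 h21\<close>: receiver 1 speaks first; \<open>First21 h21 h12\<close>: receiver 2 speaks first.
\<close>

datatype ('y1, 'y2) conference =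
    First12 "(nat \<Rightarrow> 'y1) \<Rightarrow> nat" "(nat \<Rightarrow> 'y2) \<Rightarrow> nat \<Rightarrow> nat"
  | First21 "(nat \<Rightarrow> 'y2) \<Rightarrow> nat" "(nat \<Rightarrow> 'y1) \<Rightarrow> nat \<Rightarrow> nat"

text \<open>The pair \<open>(w12, w21)\<close> exchanged on given channel outputs.\<close>

fun exchange ::
  "('y1, 'y2) conference \<Rightarrow> (nat \<Rightarrow> 'y1) \<Rightarrow> (nat \<Rightarrow> 'y2) \<Rightarrow> nat \<times> nat" where
  "exchange (First12 h12 h21) y1 y2 = (h12 y1, h21 y2 (h12 y1))"
| "exchange (First21 h21 h12) y1 y2 = (h12 y1 (h21 y2), h21 y2)"

fun is_conference :: "nat \<Rightarrow> real \<Rightarrow> real \<Rightarrow> ('y1, 'y2) conference \<Rightarrow> bool" where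
  "is_conference n R12 R21 (First12 h12 h21) \<longleftrightarrow>
     h12 \<in> words n \<rightarrow> messages n R12 \<and>
     h21 \<in> words n \<rightarrow> messages n R12 \<rightarrow> messages n R21"
| "is_conference n R12 R21 (First21 h21 h12) \<longleftrightarrow>
     h21 \<in> words n \<rightarrow> messages n R21 \<and>
     h12 \<in> words n \<rightarrow> messages n R21 \<rightarrow> messages n R12"

record ('x, 'y1, 'y2) code =
  encoder :: "nat \<Rightarrow> nat \<Rightarrow> 'x"
  conf :: "('y1, 'y2) conference"
  decoder1 :: "nat \<Rightarrow> (nat \<Rightarrow> 'y1) \<Rightarrow> nat"
  decoder2 :: "nat \<Rightarrow> (nat \<Rightarrow> 'y2) \<Rightarrow> nat"

definition is_code :: "real \<Rightarrow> real \<Rightarrow> nat \<Rightarrow> real \<Rightarrow> ('x, 'y1, 'y2) code \<Rightarrow> bool" where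
  "is_code C12 C21 n R c \<longleftrightarrow>
     0 \<le> R \<and> encoder c \<in> messages n R \<rightarrow> words n \<and>
     (\<exists>R12 R21. 0 \<le> R12 \<and> R12 \<le> C12 \<and> 0 \<le> R21 \<and> R21 \<le> C21 \<and>
        is_conference n R12 R21 (conf c) \<and>
        decoder1 c \<in> messages n R21 \<rightarrow> words n \<rightarrow> messages n R \<and>
        decoder2 c \<in> messages n R12 \<rightarrow> words n \<rightarrow> messages n R)"

definition error_prob ::
  "('x \<Rightarrow> ('y1 \<times> 'y2) pmf) \<Rightarrow> nat \<Rightarrow> real \<Rightarrow> ('x, 'y1, 'y2) code \<Rightarrow> real" where
  "error_prob W n R c =
     measure_pmf.prob
       (bind_pmf (pmf_of_set (messages n R)) (\<lambda>w.
          map_pmf (\<lambda>(y1, y2). (w, y1, y2)) (channel_block W n (encoder c w))))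
       {(w, y1, y2). decoder1 c (snd (exchange (conf c) y1 y2)) y1 \<noteq> w \<or>
                     decoder2 c (fst (exchange (conf c) y1 y2)) y2 \<noteq> w}"

definition reliable_codes ::
  "('x \<Rightarrow> ('y1 \<times> 'y2) pmf) \<Rightarrow> real \<Rightarrow> real \<Rightarrow> (nat \<Rightarrow> real) \<Rightarrow> bool" where
  "reliable_codes W C12 C21 r \<longleftrightarrow>
     (\<exists>c. (\<forall>n. is_code C12 C21 n (r n) (c n)) \<and> (\<lambda>n. error_prob W n (r n) (c n)) \<longlonglongrightarrow> 0)"

text \<open>
  \<open>achievable\<close> asks for block codes with rate exactly \<open>R\<close>.  At the supremum of the achievable rates
  such codes need not exist (for a noisy binary symmetric channel of positive capacity, used at
  capacity with both receivers seeing the same output, the error probability of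
  the best codes with exactly \<open>2^(n R)\<close> messages does not vanish).  There achievability means
  codes whose rates converge to \<open>R\<close>.
\<close>

definition achievable ::
  "('x \<Rightarrow> ('y1 \<times> 'y2) pmf) \<Rightarrow> real \<Rightarrow> real \<Rightarrow> real \<Rightarrow> bool" where
  "achievable W C12 C21 R \<longleftrightarrow> reliable_codes W C12 C21 (\<lambda>_. R)"

definition achievable_limit ::
  "('x \<Rightarrow> ('y1 \<times> 'y2) pmf) \<Rightarrow> real \<Rightarrow> real \<Rightarrow> real \<Rightarrow> bool" where
  "achievable_limit W C12 C21 R \<longleftrightarrow> (\<exists>r. r \<longlonglongrightarrow> R \<and> reliable_codes W C12 C21 r)"

end

theory Submission
  imports Defs
begin

text \<open>
  One-shot random coding for the order \<open>1 \<rightarrow> 2\<close>; the other order follows by exchanging the receivers.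
  Receiver 1 quantizes \<open>y1\<close> to a word \<open>v\<close> of a random codebook and sends a random hash of its index.
  Receiver 2 looks for the message \<open>w\<close> such that some \<open>v'\<close> with the received hash fits
  \<open>(x(w), y2)\<close>, without having to identify the quantized word.  It then returns a random
  hash of \<open>w\<close>, which receiver 1 combines with \<open>y1\<close>.

  Typicality is replaced by threshold tests on products of single-letter density ratios:
  under independent inputs such a product has expectation at most 1, so a threshold \<open>2 powr (n a)\<close> is
  passed with probability at most \<open>2 powr (- n a)\<close>, while under the true law its logarithm concentrates.
  The Markov lemma is avoided by letting receiver 1 choose only words \<open>v\<close> for which the conditional probability,
  given \<open>(y1, v)\<close>, that \<open>(x, y2)\<close> fails the later tests is small.
  The resulting constraints \<open>R < I(X;Y2,V)\<close>,
  \<open>R < I(X;Y2) - I(V;Y1|Y2,X) + C12\<close> and \<open>R < I(X;Y1) + C21\<close> are those of \<open>rate_12\<close>, because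
  \<open>V\<close> depends on the rest only through \<open>Y1\<close>.
\<close>

section \<open>Probabilities of events under discrete distributions\<close>

lemma prob_bind_pmf: "measure_pmf.prob (bind_pmf M f) S = (\<integral>x. measure_pmf.prob (f x) S \<partial>measure_pmf M)"
proof -
  have "measure_pmf.prob (bind_pmf M f) S = pmf (bind_pmf M (\<lambda>x. map_pmf (\<lambda>y. y \<in> S) (f x))) True"
    by (simp add: map_bind_pmf[symmetric] pmf_map vimage_def)
  also have "\<dots> = (\<integral>x. measure_pmf.prob (f x) S \<partial>measure_pmf M)"
    by (simp add: pmf_bind pmf_map vimage_def)
  finally show ?thesis .
qed

lemma integrable_prob_pmf [simp]:
  "integrable (measure_pmf M) (\<lambda>x. measure_pmf.prob (f x) (S x))"
  by (rule measure_pmf.integrable_const_bound[where B=1]) auto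

text \<open>The affine form \<open>a * _ + c\<close> lets one comparison carry both the factor
  \<open>1 / s\<close> of Markov's inequality and the additive exponential term of the covering
  lemma. Taking \<open>a = 0\<close> turns it into a plain uniform bound.\<close>

lemma prob_bind_pmf_mono:
  assumes "\<And>x. x \<in> set_pmf M \<Longrightarrow> measure_pmf.prob (f x) S \<le> a * measure_pmf.prob (g x) T + c"
  shows "measure_pmf.prob (bind_pmf M f) S \<le> a * measure_pmf.prob (bind_pmf M g) T + c"
proof -
  have "measure_pmf.prob (bind_pmf M f) S \<le> (\<integral>x. a * measure_pmf.prob (g x) T + c \<partial>measure_pmf M)"
    unfolding prob_bind_pmf using assms by (intro integral_mono_AE) (auto simp: AE_measure_pmf_iff)
  then show ?thesis by (simp add: prob_bind_pmf)
qed

lemma prob_bind_pmf_le: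
  assumes "\<And>x. x \<in> set_pmf M \<Longrightarrow> measure_pmf.prob (f x) S \<le> c"
  shows "measure_pmf.prob (bind_pmf M f) S \<le> c"
  using prob_bind_pmf_mono[of M f S 0 f S c] assms by simp

text \<open>The derandomization step of random coding: were every point worse than \<open>c\<close>,
  the mean would exceed \<open>c\<close>. That the point lies in the support is what later makes the
  chosen codewords and hash values legitimate.\<close>

lemma prob_bind_pmf_le_exists:
  assumes "measure_pmf.prob (bind_pmf M f) S \<le> c"
  shows "\<exists>x\<in>set_pmf M. measure_pmf.prob (f x) S \<le> c"
proof (rule ccontr)
  assume "\<not> ?thesis"
  then have "c < (\<integral>x. measure_pmf.prob (f x) S \<partial>measure_pmf M)"
    by (intro measure_pmf.expectation_greater) (auto simp: AE_measure_pmf_iff not_le)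
  with assms show False by (simp add: prob_bind_pmf)
qed

lemma prob_map_pmf: "measure_pmf.prob (map_pmf f M) S = measure_pmf.prob M {x. f x \<in> S}"
  by (simp add: vimage_def)

lemma prob_pair_pmf:
  "measure_pmf.prob (pair_pmf A B) S = (\<integral>a. measure_pmf.prob B {b. (a, b) \<in> S} \<partial>measure_pmf A)"
proof -
  have "pair_pmf A B = bind_pmf A (\<lambda>a. map_pmf (Pair a) B)"
    by (simp add: pair_pmf_def map_pmf_def)
  then show ?thesis by (simp only: prob_bind_pmf prob_map_pmf)
qed

lemma prob_pair_pmf_le:
  assumes "\<And>a. a \<in> set_pmf A \<Longrightarrow> measure_pmf.prob B {b. (a, b) \<in> S} \<le> c"
  shows "measure_pmf.prob (pair_pmf A B) S \<le> c"
  unfolding prob_pair_pmf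
  by (rule measure_pmf.integral_le_const) (auto simp: AE_measure_pmf_iff assms)

lemma prob_pair_pmf_le':
  assumes "\<And>b. b \<in> set_pmf B \<Longrightarrow> measure_pmf.prob A {a. (a, b) \<in> S} \<le> c"
  shows "measure_pmf.prob (pair_pmf A B) S \<le> c"
  by (subst pair_commute_pmf, subst prob_map_pmf, rule prob_pair_pmf_le) (use assms in auto)

text \<open>Factors a conditional bound out of a joint event although \<open>R\<close> may depend on
  \<open>a\<close>. In the application \<open>a\<close> contains the quantization codebook, on which
  the colliding index depends, while \<open>b\<close> contains the hash.\<close>

lemma prob_pair_pmf_mult_le:
  assumes "\<And>a. P a \<Longrightarrow> measure_pmf.prob B {b. R a b} \<le> c" "0 \<le> c"
  shows "measure_pmf.prob (pair_pmf A B) {(a, b). P a \<and> R a b} \<le> c * measure_pmf.prob A {a. P a}"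
proof -
  have "measure_pmf.prob (pair_pmf A B) {(a, b). P a \<and> R a b}
      \<le> (\<integral>a. c * indicator {a. P a} a \<partial>measure_pmf A)"
    unfolding prob_pair_pmf
    by (intro integral_mono_AE integrable_mult_right integrable_prob_pmf integrable_real_indicator)
       (auto simp: indicator_def assms measure_pmf.emeasure_eq_measure)
  then show ?thesis by simp
qed

text \<open>Markov's inequality for conditional probabilities; \<open>P a\<close> will say that the
  conditional failure probability exceeds the level \<open>c\<close>.\<close>

lemma prob_pair_pmf_mult_ge:
  assumes "\<And>a. P a \<Longrightarrow> c \<le> measure_pmf.prob B {b. (a, b) \<in> S}"
  shows "c * measure_pmf.prob A {a. P a} \<le> measure_pmf.prob (pair_pmf A B) S"
proof -
  have "(\<integral>a. c * indicator {a. P a} a \<partial>measure_pmf A) \<le> measure_pmf.prob (pair_pmf A B) S"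
    unfolding prob_pair_pmf
    by (intro integral_mono_AE integrable_mult_right integrable_prob_pmf integrable_real_indicator)
       (auto simp: indicator_def assms measure_pmf.emeasure_eq_measure)
  then show ?thesis by simp
qed

lemma prob_pmf_mono:
  assumes "\<And>x. x \<in> set_pmf M \<Longrightarrow> x \<in> S \<Longrightarrow> x \<in> T"
  shows "measure_pmf.prob M S \<le> measure_pmf.prob M T"
  by (rule measure_pmf.finite_measure_mono_AE) (auto simp: AE_measure_pmf_iff assms)

lemma prob_pmf_Un: "measure_pmf.prob M (S \<union> T) \<le> measure_pmf.prob M S + measure_pmf.prob M T"
  by (rule measure_Un_le) auto

lemma prob_pmf_union_bound:
  assumes "finite I" "\<And>i. i \<in> I \<Longrightarrow> measure_pmf.prob M (S i) \<le> c"
  shows "measure_pmf.prob M (\<Union>i\<in>I. S i) \<le> real (card I) * c"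
proof -
  have "measure_pmf.prob M (\<Union>i\<in>I. S i) \<le> (\<Sum>i\<in>I. measure_pmf.prob M (S i))"
    using assms by (intro measure_pmf.finite_measure_subadditive_finite) auto
  also have "\<dots> \<le> real (card I) * c"
    using assms by (intro order.trans[OF sum_bounded_above[of I _ c]]) auto
  finally show ?thesis .
qed

text \<open>\<open>C y\<close> is the conditional law of the second component given that the first
  equals \<open>y\<close>. It is obtained by conditioning on a fibre, so it carries information only
  for \<open>y\<close> in the support of \<open>p\<close>, and the outer \<open>bind_pmf\<close>
  looks at no other \<open>y\<close>.\<close>

lemma disintegration_pmf:
  fixes J :: "('a \<times> 'b) pmf"
  obtains p C where "J = bind_pmf p (\<lambda>y. map_pmf (Pair y) (C y))" "p = map_pmf fst J"
proof -
  define C where "C y = map_pmf snd (cond_pmf J {z. fst z = y})" for y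
  have "bind_pmf (map_pmf fst J) (\<lambda>y. map_pmf (Pair y) (C y))
      = bind_pmf (map_pmf fst J) (\<lambda>y. cond_pmf J {z. fst z = y})"
  proof (rule bind_pmf_cong[OF refl])
    fix y assume "y \<in> set_pmf (map_pmf fst J)"
    then have "set_pmf J \<inter> {z. fst z = y} \<noteq> {}" by auto
    then have "map_pmf (Pair y \<circ> snd) (cond_pmf J {z. fst z = y}) = map_pmf id (cond_pmf J {z. fst z = y})"
      by (intro map_pmf_cong) (auto simp: set_cond_pmf)
    then show "map_pmf (Pair y) (C y) = cond_pmf J {z. fst z = y}"
      by (simp add: C_def pmf.map_comp)
  qed
  also have "\<dots> = J"
  proof (rule bind_cond_pmf_cancel)
    fix z assume "z \<in> set_pmf J"
    then show "set_pmf (map_pmf fst J) \<inter> {x. fst z = x} \<noteq> {}" by auto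
  next
    fix x assume "x \<in> set_pmf (map_pmf fst J)"
    then show "set_pmf J \<inter> {y. fst y = x} \<noteq> {}" by auto
  next
    fix x and z :: "'a \<times> 'b" assume "fst z = x"
    then show "measure_pmf.prob J {y. fst y = x} = measure_pmf.prob (map_pmf fst J) {x. fst z = x}"
      by (auto simp: prob_map_pmf intro!: arg_cong[where f = "measure_pmf.prob J"])
  qed
  finally show thesis using that by metis
qed

section \<open>One-shot coding\<close>

text \<open>
  Here \<open>exp (- M / t)\<close> bounds the chance that no codeword passes, since a word drawn from \<open>PV\<close>
  passes with at least \<open>1 / t\<close> times its probability under \<open>Q y\<close>.
\<close>

lemma covering_pmf:
  fixes p :: "'b pmf" and C :: "'b \<Rightarrow> 'd pmf" and Q :: "'b \<Rightarrow> 'v pmf" and PV :: "'v pmf"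
    and r :: "'b \<Rightarrow> 'v \<Rightarrow> real" and I :: "nat set"
  assumes dom: "\<And>y v. y \<in> set_pmf p \<Longrightarrow> pmf (Q y) v \<le> r y v * pmf PV v"
    and t: "0 < t" and s: "0 < s" and I: "finite I" "I \<noteq> {}"
  shows "\<exists>sel. (\<forall>y G. sel y G \<in> I) \<and>
    measure_pmf.prob (pair_pmf (bind_pmf p (\<lambda>y. map_pmf (Pair y) (C y))) (Pi_pmf I dflt (\<lambda>_. PV)))
      {((y, d), G). bad y d (G (sel y G))}
    \<le> measure_pmf.prob (bind_pmf p (\<lambda>y. map_pmf (Pair y) (Q y))) {(y, v). t < r y v}
      + measure_pmf.prob (bind_pmf p (\<lambda>y. map_pmf (Pair y) (pair_pmf (Q y) (C y)))) {(y, v, d). bad y d v} / s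
      + s + exp (- real (card I) / t)"
proof -
  define good where "good y v \<longleftrightarrow> r y v \<le> t \<and> measure_pmf.prob (C y) {d. bad y d v} \<le> s" for y v
  \<comment> \<open>When no codeword is good an arbitrary index is returned, so that
    \<open>sel\<close> always lands in \<open>I\<close>. This case is the event \<open>?A\<close>,
    and \<open>?B\<close> is failure despite a good choice.\<close>
  define sel where "sel y G = (if \<exists>m\<in>I. good y (G m) then SOME m. m \<in> I \<and> good y (G m) else SOME m. m \<in> I)"
    for y and G :: "nat \<Rightarrow> 'v"
  have sel: "sel y G \<in> I \<and> ((\<exists>m\<in>I. good y (G m)) \<longrightarrow> good y (G (sel y G)))" for y G
  proof (cases "\<exists>m\<in>I. good y (G m)")
    case True
    then have "\<exists>m. m \<in> I \<and> good y (G m)" by blast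
    from someI_ex[OF this] show ?thesis using True by (simp add: sel_def)
  next
    case False
    have "\<exists>m. m \<in> I" using I by blast
    from someI_ex[OF this] show ?thesis using False by (simp add: sel_def)
  qed
  let ?J = "bind_pmf p (\<lambda>y. map_pmf (Pair y) (C y))" and ?G = "Pi_pmf I dflt (\<lambda>_. PV)"
  let ?A = "{((y, d), G). \<forall>m\<in>I. \<not> good y (G m)}"
    and ?B = "{((y, d), G). good y (G (sel y G)) \<and> bad y d (G (sel y G))}"
  let ?S = "{((y, d), G). bad y d (G (sel y G))}"
  let ?e = "exp (- real (card I) / t)"
  have "measure_pmf.prob (pair_pmf ?J ?G) ?S \<le> measure_pmf.prob (pair_pmf ?J ?G) (?A \<union> ?B)"
    by (rule prob_pmf_mono) (use sel in blast)
  also have "\<dots> \<le> measure_pmf.prob (pair_pmf ?J ?G) ?A + measure_pmf.prob (pair_pmf ?J ?G) ?B"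
    by (rule prob_pmf_Un)
  finally have AB: "measure_pmf.prob (pair_pmf ?J ?G) ?S
      \<le> measure_pmf.prob (pair_pmf ?J ?G) ?A + measure_pmf.prob (pair_pmf ?J ?G) ?B" .
  \<comment> \<open>The codebook \<open>G\<close> is independent of \<open>(y, d)\<close>. Once
    \<open>G\<close> and \<open>y\<close> are fixed, the selected word is fixed too and
    \<open>d\<close> still has law \<open>C y\<close>, so goodness of the word bounds the failure
    directly.\<close>
  have B: "measure_pmf.prob (pair_pmf ?J ?G) ?B \<le> s"
  proof (rule prob_pair_pmf_le', rule prob_bind_pmf_le)
    fix G y
    show "measure_pmf.prob (map_pmf (Pair y) (C y)) {a. (a, G) \<in> ?B} \<le> s"
    proof (cases "good y (G (sel y G))")
      case True
      then have "measure_pmf.prob (C y) {d. bad y d (G (sel y G))} \<le> s" by (simp add: good_def)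
      with True show ?thesis by (simp add: prob_map_pmf)
    next
      case False
      with s show ?thesis by (simp add: prob_map_pmf)
    qed
  qed
  have none: "measure_pmf.prob ?G {G. \<forall>m\<in>I. \<not> good y (G m)} \<le> measure_pmf.prob (Q y) {v. \<not> good y v} + ?e"
    if y: "y \<in> set_pmf p" for y
  proof -
    let ?\<pi> = "measure_pmf.prob PV {v. good y v}" and ?\<rho> = "measure_pmf.prob (Q y) {v. good y v}"
    have "{G. \<forall>m\<in>I. \<not> good y (G m)} = Pi I (\<lambda>_. - {v. good y v})" by auto
    then have "measure_pmf.prob ?G {G. \<forall>m\<in>I. \<not> good y (G m)} = (1 - ?\<pi>) ^ card I"
      using I by (simp add: measure_Pi_pmf_Pi measure_pmf.prob_compl[of "{v. good y v}" PV, simplified] Compl_eq_Diff_UNIV)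
    also have "\<dots> \<le> exp (- ?\<pi>) ^ card I"
      using exp_ge_add_one_self[of "- ?\<pi>"] by (intro power_mono) auto
    also have "\<dots> = exp (- (real (card I) * ?\<pi>))"
      by (simp add: exp_of_nat_mult[symmetric])
    \<comment> \<open>On good words the density is at most \<open>t\<close>, so summing
      \<open>dom\<close> over them gives \<open>?\<rho> \<le> t * ?\<pi>\<close>.\<close>
    also have "\<dots> \<le> exp (- (real (card I) / t * ?\<rho>))"
    proof -
      have "?\<rho> = infsetsum (pmf (Q y)) {v. good y v}" by (rule measure_pmf_conv_infsetsum)
      also have "\<dots> \<le> infsetsum (\<lambda>v. t * pmf PV v) {v. good y v}"
      proof (rule infsetsum_mono)
        fix v assume "v \<in> {v. good y v}"
        then have "r y v * pmf PV v \<le> t * pmf PV v"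
          by (intro mult_right_mono) (auto simp: good_def)
        with dom[OF y, of v] show "pmf (Q y) v \<le> t * pmf PV v" by simp
      qed (auto intro: pmf_abs_summable abs_summable_on_cmult_right)
      also have "\<dots> = t * ?\<pi>"
        by (simp add: infsetsum_cmult_right pmf_abs_summable measure_pmf_conv_infsetsum)
      finally have "?\<rho> / t \<le> ?\<pi>" using t by (simp add: field_simps)
      then have "real (card I) * (?\<rho> / t) \<le> real (card I) * ?\<pi>" by (intro mult_left_mono) auto
      then show ?thesis by simp
    qed
    also have "\<dots> \<le> 1 - ?\<rho> + ?e"
    proof -
      have "convex_on UNIV (exp :: real \<Rightarrow> real)"
        by (rule convex_on_exp[of 1, simplified])
      \<comment> \<open>On \<open>[0, 1]\<close> the convex function exp lies below the chord
        through its endpoint values. This separates the probability of a bad word under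
        \<open>Q y\<close> from the exponential term.\<close>
      from convex_onD[OF this, of ?\<rho> 0 "- real (card I) / t"]
      have "exp (?\<rho> * (- real (card I) / t)) \<le> (1 - ?\<rho>) + ?\<rho> * ?e" by simp
      moreover have "?\<rho> * ?e \<le> 1 * ?e" by (intro mult_right_mono) auto
      moreover have "exp (- (real (card I) / t * ?\<rho>)) = exp (?\<rho> * (- real (card I) / t))"
        by (simp add: mult.commute)
      ultimately show ?thesis by linarith
    qed
    also have "1 - ?\<rho> = measure_pmf.prob (Q y) {v. \<not> good y v}"
      using measure_pmf.prob_compl[of "{v. good y v}" "Q y"] by (simp add: Collect_neg_eq Compl_eq_Diff_UNIV)
    finally show ?thesis .
  qed
  let ?PQ = "bind_pmf p (\<lambda>y. map_pmf (Pair y) (Q y))"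
  have "pair_pmf ?J ?G = bind_pmf p (\<lambda>y. pair_pmf (map_pmf (Pair y) (C y)) ?G)"
    by (simp add: pair_pmf_def bind_assoc_pmf)
  also have "measure_pmf.prob \<dots> ?A \<le> 1 * measure_pmf.prob ?PQ {(y, v). \<not> good y v} + ?e"
  proof (rule prob_bind_pmf_mono, rule prob_pair_pmf_le)
    fix y a assume "y \<in> set_pmf p" "a \<in> set_pmf (map_pmf (Pair y) (C y))"
    with none[of y] show "measure_pmf.prob ?G {b. (a, b) \<in> ?A}
        \<le> 1 * measure_pmf.prob (map_pmf (Pair y) (Q y)) {(y, v). \<not> good y v} + ?e"
      by (auto simp: prob_map_pmf)
  qed
  also have "measure_pmf.prob ?PQ {(y, v). \<not> good y v}
     \<le> measure_pmf.prob ?PQ ({(y, v). t < r y v} \<union> {(y, v). s < measure_pmf.prob (C y) {d. bad y d v}})"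
    by (rule prob_pmf_mono) (auto simp: good_def)
  also have "\<dots> \<le> measure_pmf.prob ?PQ {(y, v). t < r y v}
      + measure_pmf.prob ?PQ {(y, v). s < measure_pmf.prob (C y) {d. bad y d v}}"
    by (rule prob_pmf_Un)
  \<comment> \<open>Markov's inequality at level \<open>s\<close>: \<open>v\<close> and
    \<open>d\<close> are independent given \<open>y\<close>, so the inner probability is the
    conditional failure probability given \<open>(y, v)\<close>.\<close>
  also have "measure_pmf.prob ?PQ {(y, v). s < measure_pmf.prob (C y) {d. bad y d v}}
     \<le> (1 / s) * measure_pmf.prob (bind_pmf p (\<lambda>y. map_pmf (Pair y) (pair_pmf (Q y) (C y)))) {(y, v, d). bad y d v} + 0"
  proof (rule prob_bind_pmf_mono)
    fix y
    have "s * measure_pmf.prob (Q y) {v. s < measure_pmf.prob (C y) {d. bad y d v}}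
       \<le> measure_pmf.prob (pair_pmf (Q y) (C y)) {(v, d). bad y d v}"
      by (rule prob_pair_pmf_mult_ge) simp
    then show "measure_pmf.prob (map_pmf (Pair y) (Q y)) {(y, v). s < measure_pmf.prob (C y) {d. bad y d v}}
       \<le> 1 / s * measure_pmf.prob (map_pmf (Pair y) (pair_pmf (Q y) (C y))) {(y, v, d). bad y d v} + 0"
      using s by (simp add: prob_map_pmf field_simps case_prod_unfold)
  qed
  finally show ?thesis using AB B sel by (intro exI[of _ sel]) auto
qed

section \<open>Product laws, random hashing and unique decoding\<close>

lemma prob_pair_pmf_mono:
  assumes "\<And>a. a \<in> set_pmf A \<Longrightarrow> measure_pmf.prob B {b. (a, b) \<in> S} \<le> measure_pmf.prob B' {b. (a, b) \<in> S'}"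
  shows "measure_pmf.prob (pair_pmf A B) S \<le> measure_pmf.prob (pair_pmf A B') S'"
  unfolding prob_pair_pmf using assms by (intro integral_mono_AE) (auto simp: AE_measure_pmf_iff)

lemma prob_pair_pmf_fst: "measure_pmf.prob (pair_pmf A B) {(a, b). P a} = measure_pmf.prob A {a. P a}"
proof -
  have "measure_pmf.prob A {a. P a} = measure_pmf.prob (map_pmf fst (pair_pmf A B)) {a. P a}"
    by (simp only: map_fst_pair_pmf)
  then show ?thesis by (simp add: prob_map_pmf case_prod_unfold)
qed

lemma prob_pair_pmf_assoc:
  "measure_pmf.prob (pair_pmf A (pair_pmf B C)) S
    = measure_pmf.prob (pair_pmf (pair_pmf A B) C) {((a, b), c). (a, b, c) \<in> S}"
  by (subst pair_pair_pmf, subst prob_map_pmf) (simp add: case_prod_unfold)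

lemma prob_pmf_of_set_singleton_le: "0 < L \<Longrightarrow> measure_pmf.prob (pmf_of_set {1..L}) {a} \<le> 1 / real L"
  by (simp add: measure_pmf_single pmf_of_set indicator_def)

text \<open>Coordinate \<open>i\<close> is redrawn after all others: then \<open>h j\<close> is a
  fixed number and \<open>h i\<close> is uniform on \<open>{1..L}\<close>. Only an inequality is
  claimed, since the fixed number may lie outside \<open>{1..L}\<close>.\<close>

lemma hash_collision_pmf:
  assumes "finite I" "i \<in> I" "i \<noteq> j" "0 < L"
  shows "measure_pmf.prob (Pi_pmf I dflt (\<lambda>_. pmf_of_set {1..L})) {h. h i = h j} \<le> 1 / real L"
proof -
  have "Pi_pmf (insert i (I - {i})) dflt (\<lambda>_. pmf_of_set {1..L})
      = map_pmf (\<lambda>(y, f). f(i := y)) (pair_pmf (pmf_of_set {1..L}) (Pi_pmf (I - {i}) dflt (\<lambda>_. pmf_of_set {1..L})))"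
    using assms by (intro Pi_pmf_insert) auto
  moreover have "insert i (I - {i}) = I" using assms by auto
  moreover have "measure_pmf.prob (pair_pmf (pmf_of_set {1..L}) (Pi_pmf (I - {i}) dflt (\<lambda>_. pmf_of_set {1..L})))
     {x. (case x of (y, f) \<Rightarrow> f(i := y)) i = (case x of (y, f) \<Rightarrow> f(i := y)) j} \<le> 1 / real L"
  proof (rule prob_pair_pmf_le')
    fix f :: "'a \<Rightarrow> nat"
    show "measure_pmf.prob (pmf_of_set {1..L}) {a. (a, f) \<in> {x. (case x of (y, f) \<Rightarrow> f(i := y)) i
        = (case x of (y, f) \<Rightarrow> f(i := y)) j}} \<le> 1 / real L"
      using assms prob_pmf_of_set_singleton_le[of L "f j"] by simp
  qed
  ultimately show ?thesis by (simp add: prob_map_pmf)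
qed

text \<open>The value \<open>1\<close> replaces a declared failure, so that a decoder is total and
  returns a legitimate message even when no candidate, or more than one, survives.\<close>

definition unique_message :: "nat \<Rightarrow> (nat \<Rightarrow> bool) \<Rightarrow> nat" where
  "unique_message N cand = (if \<exists>!w. w \<in> {1..N} \<and> cand w then THE w. w \<in> {1..N} \<and> cand w else 1)"

lemma unique_message_eq:
  assumes "w \<in> {1..N}" "cand w" "\<And>w'. w' \<in> {1..N} \<Longrightarrow> w' \<noteq> w \<Longrightarrow> \<not> cand w'"
  shows "unique_message N cand = w"
proof -
  have "\<exists>!w. w \<in> {1..N} \<and> cand w" using assms by blast
  then show ?thesis
    unfolding unique_message_def using assms by (auto intro!: the_equality)
qed

lemma unique_message_in: "0 < N \<Longrightarrow> unique_message N cand \<in> {1..N}"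
proof (cases "\<exists>!w. w \<in> {1..N} \<and> cand w")
  case True
  from theI'[OF this] True show ?thesis by (simp add: unique_message_def)
qed (auto simp: unique_message_def)

text \<open>Four kinds of failure add up. \<open>?c0\<close> covers a failed quantization and true
  words that fail a test. A wrong message accepted together with the selected word costs
  \<open>N * \<alpha>1\<close>, one accepted with another word of the same hash costs
  \<open>N * M * \<alpha>2 / L12\<close>, and one accepted by receiver 1 costs
  \<open>N * \<alpha>3 / L21\<close>. The bounds on the tests are uniform in the received words
  because a competing codeword is independent of them. \<open>P\<close> and \<open>K\<close> are
  arbitrary, so that whole blocks can be inserted.\<close>

lemma one_shot_conference:
  fixes P :: "'a pmf" and K :: "'a \<Rightarrow> ('b \<times> 'c) pmf" and Q :: "'b \<Rightarrow> 'v pmf" and PV :: "'v pmf"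
    and r :: "'b \<Rightarrow> 'v \<Rightarrow> real" and T1 T2 :: "'a \<Rightarrow> 'c \<Rightarrow> 'v \<Rightarrow> bool" and T3 :: "'a \<Rightarrow> 'b \<Rightarrow> bool"
    and N M L12 L21 :: nat
  assumes dom: "\<And>x y1 y2 v. x \<in> set_pmf P \<Longrightarrow> (y1, y2) \<in> set_pmf (K x) \<Longrightarrow> pmf (Q y1) v \<le> r y1 v * pmf PV v"
    and T1: "\<And>y2 v. measure_pmf.prob P {x. T1 x y2 v} \<le> \<alpha>1"
    and T2: "\<And>y2. measure_pmf.prob (pair_pmf P PV) {(x, v). T2 x y2 v} \<le> \<alpha>2"
    and T3: "\<And>y1. measure_pmf.prob P {x. T3 x y1} \<le> \<alpha>3"
    and t: "0 < t" and s: "0 < s" and pos: "0 < N" "0 < M" "0 < L12" "0 < L21"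
  defines "JQ \<equiv> bind_pmf P (\<lambda>x. bind_pmf (K x) (\<lambda>(y1, y2). map_pmf (\<lambda>v. (x, y1, y2, v)) (Q y1)))"
  shows "\<exists>enc h12 h21 d1 d2. ((\<forall>w\<in>{1..N}. enc w \<in> set_pmf P) \<and> (\<forall>y. h12 y \<in> {1..L12}) \<and>
    (\<forall>y b. h21 y b \<in> {1..L21}) \<and> (\<forall>b y. d1 b y \<in> {1..N}) \<and> (\<forall>b y. d2 b y \<in> {1..N})) \<and>
    measure_pmf.prob (bind_pmf (pmf_of_set {1..N}) (\<lambda>w. map_pmf (\<lambda>(y1, y2). (w, y1, y2)) (K (enc w))))
      {(w, y1, y2). d1 (h21 y2 (h12 y1)) y1 \<noteq> w \<or> d2 (h12 y1) y2 \<noteq> w}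
    \<le> measure_pmf.prob JQ {(x, y1, y2, v). t < r y1 v}
      + measure_pmf.prob JQ {(x, y1, y2, v). \<not> (T1 x y2 v \<and> T2 x y2 v \<and> T3 x y1)} / s
      + s + exp (- real M / t) + real N * \<alpha>1 + real N * real M * \<alpha>2 / real L12 + real N * \<alpha>3 / real L21"
    (is "\<exists>enc h12 h21 d1 d2. ?ok enc h12 h21 d1 d2 \<and> ?err enc h12 h21 d1 d2 \<le> ?c0 + real N * \<alpha>1 + ?c2 + ?c3")
proof -
  let ?I = "{1..M}" and ?N = "{1..N}"
  \<comment> \<open>The joint law of \<open>(x, y1, y2)\<close> is disintegrated along
    \<open>y1\<close>, because the covering lemma starts from the word that is quantized.\<close>
  define J where "J = bind_pmf P (\<lambda>x. map_pmf (Pair x) (K x))"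
  obtain p C where J': "map_pmf (\<lambda>(x, y1, y2). (y1, x, y2)) J = bind_pmf p (\<lambda>y. map_pmf (Pair y) (C y))"
    and p: "p = map_pmf fst (map_pmf (\<lambda>(x, y1, y2). (y1, x, y2)) J)"
    by (rule disintegration_pmf)
  have J: "J = map_pmf (\<lambda>(y1, x, y2). (x, y1, y2)) (bind_pmf p (\<lambda>y. map_pmf (Pair y) (C y)))"
    unfolding J'[symmetric] pmf.map_comp by (simp add: o_def case_prod_unfold)
  have JQ_J: "JQ = bind_pmf J (\<lambda>(x, y1, y2). map_pmf (\<lambda>v. (x, y1, y2, v)) (Q y1))"
    by (simp add: JQ_def J_def bind_assoc_pmf bind_map_pmf case_prod_unfold)
  also have "\<dots> = map_pmf (\<lambda>(y, v, x, y2). (x, y, y2, v)) (bind_pmf p (\<lambda>y. map_pmf (Pair y) (pair_pmf (Q y) (C y))))"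
  proof -
    have "bind_pmf J (\<lambda>(x, y1, y2). map_pmf (\<lambda>v. (x, y1, y2, v)) (Q y1))
      = bind_pmf p (\<lambda>y. bind_pmf (C y) (\<lambda>d. bind_pmf (Q y) (\<lambda>v. return_pmf (fst d, y, snd d, v))))"
      by (simp add: J bind_assoc_pmf bind_map_pmf map_bind_pmf map_pmf_def case_prod_unfold bind_return_pmf)
    \<comment> \<open>Given \<open>y1\<close>, the word \<open>v\<close> and the pair
      \<open>(x, y2)\<close> are independent, so the order of the two draws can be
      exchanged.\<close>
    also have "\<dots> = bind_pmf p (\<lambda>y. bind_pmf (Q y) (\<lambda>v. bind_pmf (C y) (\<lambda>d. return_pmf (fst d, y, snd d, v))))"
      by (rule bind_pmf_cong[OF refl], rule bind_commute_pmf)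
    also have "\<dots> = map_pmf (\<lambda>(y, v, x, y2). (x, y, y2, v)) (bind_pmf p (\<lambda>y. map_pmf (Pair y) (pair_pmf (Q y) (C y))))"
      by (simp add: pair_pmf_def map_pmf_def bind_assoc_pmf bind_return_pmf case_prod_unfold)
    finally show ?thesis .
  qed
  finally have JQ: "JQ = map_pmf (\<lambda>(y, v, x, y2). (x, y, y2, v)) (bind_pmf p (\<lambda>y. map_pmf (Pair y) (pair_pmf (Q y) (C y))))" .
  let ?bad = "\<lambda>y (x, y2) v. \<not> (T1 x y2 v \<and> T2 x y2 v \<and> T3 x y)"
  have "\<exists>sel. (\<forall>y G. sel y G \<in> ?I) \<and>
    measure_pmf.prob (pair_pmf (bind_pmf p (\<lambda>y. map_pmf (Pair y) (C y))) (Pi_pmf ?I undefined (\<lambda>_. PV)))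
      {((y, d), G). ?bad y d (G (sel y G))}
    \<le> measure_pmf.prob (bind_pmf p (\<lambda>y. map_pmf (Pair y) (Q y))) {(y, v). t < r y v}
      + measure_pmf.prob (bind_pmf p (\<lambda>y. map_pmf (Pair y) (pair_pmf (Q y) (C y)))) {(y, v, d). ?bad y d v} / s
      + s + exp (- real (card ?I) / t)"
    by (rule covering_pmf) (use t s pos in \<open>auto simp: p J_def intro: dom\<close>)
  then obtain sel where sel: "\<And>y G. sel y G \<in> ?I" and cover:
    "measure_pmf.prob (pair_pmf (bind_pmf p (\<lambda>y. map_pmf (Pair y) (C y))) (Pi_pmf ?I undefined (\<lambda>_. PV)))
      {((y, d), G). ?bad y d (G (sel y G))}
    \<le> measure_pmf.prob (bind_pmf p (\<lambda>y. map_pmf (Pair y) (Q y))) {(y, v). t < r y v}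
      + measure_pmf.prob (bind_pmf p (\<lambda>y. map_pmf (Pair y) (pair_pmf (Q y) (C y)))) {(y, v, d). ?bad y d v} / s
      + s + exp (- real (card ?I) / t)" by blast
  have "measure_pmf.prob (bind_pmf p (\<lambda>y. map_pmf (Pair y) (Q y))) {(y, v). t < r y v}
     = measure_pmf.prob JQ {(x, y1, y2, v). t < r y1 v}"
  proof -
    have "measure_pmf.prob JQ {(x, y1, y2, v). t < r y1 v}
      = measure_pmf.prob (bind_pmf p (\<lambda>y. map_pmf (Pair y) (pair_pmf (Q y) (C y)))) {(y, v, d). t < r y v}"
      by (simp add: JQ prob_map_pmf case_prod_unfold)
    then show ?thesis
      using prob_pair_pmf_fst[of "Q _" "C _" "\<lambda>v. t < r _ v"]
      by (simp add: prob_bind_pmf prob_map_pmf case_prod_unfold)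
  qed
  moreover have "measure_pmf.prob (bind_pmf p (\<lambda>y. map_pmf (Pair y) (pair_pmf (Q y) (C y)))) {(y, v, d). ?bad y d v}
     = measure_pmf.prob JQ {(x, y1, y2, v). \<not> (T1 x y2 v \<and> T2 x y2 v \<and> T3 x y1)}"
    by (simp add: JQ prob_map_pmf case_prod_unfold)
  moreover have "measure_pmf.prob (pair_pmf (bind_pmf p (\<lambda>y. map_pmf (Pair y) (C y))) (Pi_pmf ?I undefined (\<lambda>_. PV)))
      {((y, d), G). ?bad y d (G (sel y G))}
    = measure_pmf.prob (pair_pmf J (Pi_pmf ?I undefined (\<lambda>_. PV)))
      {((x, y1, y2), G). \<not> (T1 x y2 (G (sel y1 G)) \<and> T2 x y2 (G (sel y1 G)) \<and> T3 x y1)}"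
    by (simp add: J pair_map_pmf1 prob_map_pmf case_prod_unfold)
  moreover have "real (card ?I) = real M" by simp
  ultimately have E0: "measure_pmf.prob (pair_pmf J (Pi_pmf ?I undefined (\<lambda>_. PV)))
      {((x, y1, y2), G). \<not> (T1 x y2 (G (sel y1 G)) \<and> T2 x y2 (G (sel y1 G)) \<and> T3 x y1)} \<le> ?c0"
    using cover by (simp only:)

  define PF where "PF = Pi_pmf ?N undefined (\<lambda>_. P)"
  define PG where "PG = Pi_pmf ?I undefined (\<lambda>_. PV)"
  define PH where "PH = Pi_pmf ?I undefined (\<lambda>_. pmf_of_set {1..L12})"
  define PK where "PK = Pi_pmf ?N undefined (\<lambda>_. pmf_of_set {1..L21})"
  define \<Omega> where "\<Omega> = pair_pmf PF (pair_pmf PG (pair_pmf PH PK))"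
  define d2 where "d2 = (\<lambda>(F :: nat \<Rightarrow> 'a, G :: nat \<Rightarrow> 'v, h :: nat \<Rightarrow> nat, k :: nat \<Rightarrow> nat) b y2.
    unique_message N (\<lambda>w. \<exists>m\<in>?I. h m = b \<and> T1 (F w) y2 (G m) \<and> T2 (F w) y2 (G m)))"
  define d1 where "d1 = (\<lambda>(F :: nat \<Rightarrow> 'a, G :: nat \<Rightarrow> 'v, h :: nat \<Rightarrow> nat, k :: nat \<Rightarrow> nat) (b :: nat) y1.
    unique_message N (\<lambda>w. k w = b \<and> T3 (F w) y1))"
  define h12 where "h12 = (\<lambda>(F :: nat \<Rightarrow> 'a, G :: nat \<Rightarrow> 'v, h :: nat \<Rightarrow> nat, k :: nat \<Rightarrow> nat) y1. h (sel y1 G))"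
  \<comment> \<open>Receiver 2 hashes its own estimate. Once \<open>d2\<close> is right the returned
    value is \<open>k w\<close>, so receiver 1 needs a separate analysis only for collisions of
    \<open>k\<close>.\<close>
  define h21 where "h21 = (\<lambda>\<omega> :: (nat \<Rightarrow> 'a) \<times> (nat \<Rightarrow> 'v) \<times> (nat \<Rightarrow> nat) \<times> (nat \<Rightarrow> nat).
    \<lambda>y2 b. snd (snd (snd \<omega>)) (d2 \<omega> b y2))"
  define wrong where "wrong \<omega> w y1 y2 \<longleftrightarrow>
      d1 \<omega> (h21 \<omega> y2 (h12 \<omega> y1)) y1 \<noteq> w \<or> d2 \<omega> (h12 \<omega> y1) y2 \<noteq> w" for \<omega> w y1 y2
  \<comment> \<open>The hypotheses negate the four error events. A wrong message is excluded by
    \<open>T1\<close> at the selected index, where \<open>v\<close> is correlated with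
    \<open>y2\<close>, and by \<open>T2\<close> at every other index with the same hash, where
    \<open>v\<close> counts as a fresh draw.\<close>
  have correct: "\<not> wrong (F, G, h, k) w y1 y2"
    if w: "w \<in> ?N" and a: "T1 (F w) y2 (G (sel y1 G))" "T2 (F w) y2 (G (sel y1 G))" "T3 (F w) y1"
      and b1: "\<And>w'. w' \<in> ?N - {w} \<Longrightarrow> \<not> T1 (F w') y2 (G (sel y1 G))"
      and b2: "\<And>w' m. w' \<in> ?N - {w} \<Longrightarrow> m \<in> ?I \<Longrightarrow> m \<noteq> sel y1 G \<Longrightarrow> h m = h (sel y1 G) \<Longrightarrow> \<not> T2 (F w') y2 (G m)"
      and b3: "\<And>w'. w' \<in> ?N - {w} \<Longrightarrow> k w' = k w \<Longrightarrow> \<not> T3 (F w') y1"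
    for F G h k w y1 y2
  proof -
    have "d2 (F, G, h, k) (h (sel y1 G)) y2 = w"
      unfolding d2_def prod.case
    proof (rule unique_message_eq[OF w])
      show "\<exists>m\<in>?I. h m = h (sel y1 G) \<and> T1 (F w) y2 (G m) \<and> T2 (F w) y2 (G m)"
        using sel a by blast
    next
      fix w' assume "w' \<in> ?N" "w' \<noteq> w"
      then show "\<not> (\<exists>m\<in>?I. h m = h (sel y1 G) \<and> T1 (F w') y2 (G m) \<and> T2 (F w') y2 (G m))"
        using b1 b2 by blast
    qed
    moreover have "d1 (F, G, h, k) (k w) y1 = w"
      unfolding d1_def prod.case by (rule unique_message_eq[OF w]) (use a b3 in auto)
    ultimately show ?thesis by (simp add: wrong_def h12_def h21_def)
  qed
  have each: "measure_pmf.prob (bind_pmf \<Omega> (\<lambda>\<omega>. map_pmf (\<lambda>(y1, y2). (\<omega>, w, y1, y2)) (K (fst \<omega> w)))) {(\<omega>, w, y1, y2). wrong \<omega> w y1 y2}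
      \<le> ?c0 + real N * \<alpha>1 + ?c2 + ?c3" if w: "w \<in> ?N" for w
  proof -
    let ?N' = "?N - {w}"
    define PF' where "PF' = Pi_pmf ?N' undefined (\<lambda>_. P)"
    define R where "R = pair_pmf PG (pair_pmf PH PK)"
    let ?\<Omega>' = "pair_pmf J (pair_pmf PF' R)"
    \<comment> \<open>The codeword of \<open>w\<close> is split off the codebook. It is drawn
      together with the channel outputs in \<open>J\<close>, and the remaining codewords
      \<open>PF'\<close>, the quantization codebook and the hashes are independent of them.\<close>
    have "PF = Pi_pmf (insert w ?N') undefined (\<lambda>_. P)" using w by (simp add: PF_def insert_absorb)
    then have PF: "PF = bind_pmf P (\<lambda>x. bind_pmf PF' (\<lambda>F. return_pmf (F(w := x))))"
      unfolding PF'_def by (simp only: Pi_pmf_insert' finite_Diff finite_atLeastAtMost Diff_iff insert_iff simp_thms)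
    have \<Omega>: "\<Omega> = bind_pmf P (\<lambda>x. bind_pmf (pair_pmf PF' R) (\<lambda>(F, z). return_pmf (F(w := x), z)))"
    proof -
      have "\<Omega> = pair_pmf PF R" by (simp only: \<Omega>_def R_def)
      then show ?thesis by (simp only: PF pair_pmf_def bind_assoc_pmf bind_return_pmf prod.case)
    qed
    have "bind_pmf \<Omega> (\<lambda>\<omega>. map_pmf (\<lambda>(y1, y2). (\<omega>, w, y1, y2)) (K (fst \<omega> w)))
      = bind_pmf P (\<lambda>x. bind_pmf (pair_pmf PF' R) (\<lambda>(F, z). bind_pmf (K x) (\<lambda>(y1, y2). return_pmf ((F(w := x), z), w, y1, y2))))"
      unfolding \<Omega> by (simp only: bind_assoc_pmf bind_return_pmf map_pmf_def case_prod_unfold fst_conv snd_conv fun_upd_same)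
    also have "\<dots> = bind_pmf P (\<lambda>x. bind_pmf (K x) (\<lambda>(y1, y2). bind_pmf (pair_pmf PF' R) (\<lambda>(F, z). return_pmf ((F(w := x), z), w, y1, y2))))"
      unfolding case_prod_unfold by (rule bind_pmf_cong[OF refl], rule bind_commute_pmf)
    also have "\<dots> = map_pmf (\<lambda>((x, y1, y2), F, z). ((F(w := x), z), w, y1, y2)) ?\<Omega>'"
      unfolding J_def pair_pmf_def map_pmf_def
      by (simp only: bind_assoc_pmf bind_return_pmf case_prod_unfold fst_conv snd_conv)
    finally have "measure_pmf.prob (bind_pmf \<Omega> (\<lambda>\<omega>. map_pmf (\<lambda>(y1, y2). (\<omega>, w, y1, y2)) (K (fst \<omega> w)))) {(\<omega>, w, y1, y2). wrong \<omega> w y1 y2}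
       = measure_pmf.prob ?\<Omega>' {((x, y1, y2), F, z). wrong (F(w := x), z) w y1 y2}"
      by (simp add: prob_map_pmf case_prod_unfold)
    also have "\<dots> \<le> measure_pmf.prob ?\<Omega>' (
         {((x, y1, y2), F, G, h, k). \<not> (T1 x y2 (G (sel y1 G)) \<and> T2 x y2 (G (sel y1 G)) \<and> T3 x y1)}
       \<union> (\<Union>w'\<in>?N'. {((x, y1, y2), F, G, h, k). T1 (F w') y2 (G (sel y1 G))})
       \<union> (\<Union>w'\<in>?N'. \<Union>m\<in>?I. {((x, y1, y2), F, G, h, k). m \<noteq> sel y1 G \<and> h m = h (sel y1 G) \<and> T2 (F w') y2 (G m)})
       \<union> (\<Union>w'\<in>?N'. {((x, y1, y2), F, G, h, k). k w' = k w \<and> T3 (F w') y1}))" (is "_ \<le> measure_pmf.prob _ (?E0 \<union> ?E1 \<union> ?E2 \<union> ?E3)")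
    proof (rule prob_pmf_mono, rule ccontr)
      fix z assume z: "z \<in> {((x, y1, y2), F, z). wrong (F(w := x), z) w y1 y2}" and nz: "z \<notin> ?E0 \<union> ?E1 \<union> ?E2 \<union> ?E3"
      obtain x y1 y2 F G h k where [simp]: "z = ((x, y1, y2), F, G, h, k)" by (metis surj_pair)
      from nz have "\<not> wrong (F(w := x), G, h, k) w y1 y2"
        by (intro correct[OF w]) (auto simp del: atLeastAtMost_iff)
      with z show False by simp
    qed
    also have "\<dots> \<le> measure_pmf.prob ?\<Omega>' ?E0 + measure_pmf.prob ?\<Omega>' ?E1 + measure_pmf.prob ?\<Omega>' ?E2 + measure_pmf.prob ?\<Omega>' ?E3"
      using prob_pmf_Un[of ?\<Omega>' "?E0 \<union> ?E1 \<union> ?E2" ?E3] prob_pmf_Un[of ?\<Omega>' "?E0 \<union> ?E1" ?E2]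
        prob_pmf_Un[of ?\<Omega>' ?E0 ?E1] by linarith
    also have "measure_pmf.prob ?\<Omega>' ?E0 \<le> ?c0"
    proof -
      have "measure_pmf.prob ?\<Omega>' ?E0 \<le> measure_pmf.prob (pair_pmf J PG)
        {((x, y1, y2), G). \<not> (T1 x y2 (G (sel y1 G)) \<and> T2 x y2 (G (sel y1 G)) \<and> T3 x y1)}"
        unfolding R_def
      proof (rule prob_pair_pmf_mono, rule prob_pair_pmf_le, goal_cases)
        case (1 j F)
        then show ?case
          using prob_pair_pmf_fst[of PG "pair_pmf PH PK" "\<lambda>G. (j, G) \<in> {((x, y1, y2), G). \<not> (T1 x y2 (G (sel y1 G)) \<and> T2 x y2 (G (sel y1 G)) \<and> T3 x y1)}"]
          by (simp add: case_prod_unfold)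
      qed
      also have "\<dots> \<le> ?c0" unfolding PG_def by (rule E0)
      finally show ?thesis .
    qed
    \<comment> \<open>The selected word depends only on \<open>y1\<close> and \<open>G\<close>. With
      these fixed, the competing codeword still has law \<open>P\<close>, so \<open>T1\<close> can
      be applied.\<close>
    also have "measure_pmf.prob ?\<Omega>' ?E1 \<le> real (card ?N') * \<alpha>1"
    proof (rule prob_pmf_union_bound, simp, rule prob_pair_pmf_le, rule prob_pair_pmf_le')
      fix w' and j :: "'a \<times> 'b \<times> 'c" and r :: "(nat \<Rightarrow> 'v) \<times> (nat \<Rightarrow> nat) \<times> (nat \<Rightarrow> nat)" assume w': "w' \<in> ?N'"
      obtain x y1 y2 G h k where [simp]: "j = (x, y1, y2)" "r = (G, h, k)" by (metis surj_pair)
      have "measure_pmf.prob PF' {F. T1 (F w') y2 (G (sel y1 G))} = measure_pmf.prob (map_pmf (\<lambda>F. F w') PF') {x. T1 x y2 (G (sel y1 G))}"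
        by (simp add: prob_map_pmf)
      also have "map_pmf (\<lambda>F. F w') PF' = P" using w' by (simp add: PF'_def Pi_pmf_component)
      finally show "measure_pmf.prob PF' {a. (a, r) \<in> {b. (j, b) \<in> {((x, y1, y2), F, G, h, k). T1 (F w') y2 (G (sel y1 G))}}} \<le> \<alpha>1"
        using T1 by simp
    qed
    txt \<open>The hash is averaged out first: it collides with probability \<open>1 / L12\<close> whichever index was
      selected, and what remains involves only independent draws of \<open>x\<close> and \<open>v\<close>.\<close>
    also have "measure_pmf.prob ?\<Omega>' ?E2 \<le> real (card ?N') * (real (card ?I) * (1 / real L12 * \<alpha>2))"
    proof (rule prob_pmf_union_bound, simp, rule prob_pmf_union_bound, simp)
      fix w' m assume w': "w' \<in> ?N'" and m: "m \<in> ?I"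
      show "measure_pmf.prob ?\<Omega>' {((x, y1, y2), F, G, h, k). m \<noteq> sel y1 G \<and> h m = h (sel y1 G) \<and> T2 (F w') y2 (G m)} \<le> 1 / real L12 * \<alpha>2"
      proof (rule prob_pair_pmf_le)
        fix j :: "'a \<times> 'b \<times> 'c"
        obtain x y1 y2 where [simp]: "j = (x, y1, y2)" by (metis surj_pair)
        have "measure_pmf.prob (pair_pmf PF' R) {b. (j, b) \<in> {((x, y1, y2), F, G, h, k). m \<noteq> sel y1 G \<and> h m = h (sel y1 G) \<and> T2 (F w') y2 (G m)}}
          = measure_pmf.prob (pair_pmf (pair_pmf PF' PG) (pair_pmf PH PK))
             {(a, b). T2 (fst a w') y2 (snd a m) \<and> (m \<noteq> sel y1 (snd a) \<and> fst b m = fst b (sel y1 (snd a)))}"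
          unfolding R_def prob_pair_pmf_assoc by (rule arg_cong[where f = "measure_pmf.prob _"]) auto
        also have "\<dots> \<le> 1 / real L12 * measure_pmf.prob (pair_pmf PF' PG) {a. T2 (fst a w') y2 (snd a m)}"
        proof (rule prob_pair_pmf_mult_le)
          fix a
          show "measure_pmf.prob (pair_pmf PH PK) {b. m \<noteq> sel y1 (snd a) \<and> fst b m = fst b (sel y1 (snd a))} \<le> 1 / real L12"
          proof (cases "m = sel y1 (snd a)")
            case False
            have "measure_pmf.prob (pair_pmf PH PK) {b. m \<noteq> sel y1 (snd a) \<and> fst b m = fst b (sel y1 (snd a))}
               = measure_pmf.prob PH {h. h m = h (sel y1 (snd a))}"
              using False prob_pair_pmf_fst[of PH PK "\<lambda>h. h m = h (sel y1 (snd a))"] by (simp add: case_prod_unfold)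
            also have "\<dots> \<le> 1 / real L12"
              unfolding PH_def using False m pos by (intro hash_collision_pmf) auto
            finally show ?thesis .
          qed simp
        qed simp
        also have "measure_pmf.prob (pair_pmf PF' PG) {a. T2 (fst a w') y2 (snd a m)} \<le> \<alpha>2"
        proof -
          have "pair_pmf P PV = map_pmf (\<lambda>(F, G). (F w', G m)) (pair_pmf PF' PG)"
            using w' m by (simp add: map_pair PF'_def PG_def Pi_pmf_component)
          then show ?thesis using T2[of y2] by (simp add: prob_map_pmf case_prod_unfold)
        qed
        finally show "measure_pmf.prob (pair_pmf PF' R) {b. (j, b) \<in> {((x, y1, y2), F, G, h, k). m \<noteq> sel y1 G \<and> h m = h (sel y1 G) \<and> T2 (F w') y2 (G m)}}
          \<le> 1 / real L12 * \<alpha>2" by (simp add: divide_right_mono)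
      qed
    qed
    \<comment> \<open>The hash \<open>k\<close> is independent of the codewords, so the collision
      contributes the factor \<open>1 / L21\<close> on top of the test.\<close>
    also have "measure_pmf.prob ?\<Omega>' ?E3 \<le> real (card ?N') * (1 / real L21 * \<alpha>3)"
    proof (rule prob_pmf_union_bound, simp, rule prob_pair_pmf_le)
      fix w' and j :: "'a \<times> 'b \<times> 'c" assume w': "w' \<in> ?N'"
      obtain x y1 y2 where [simp]: "j = (x, y1, y2)" by (metis surj_pair)
      have "measure_pmf.prob (pair_pmf PF' R) {b. (j, b) \<in> {((x, y1, y2), F, G, h, k). k w' = k w \<and> T3 (F w') y1}}
         = measure_pmf.prob (pair_pmf PF' R) {(F, r). T3 (F w') y1 \<and> snd (snd r) w' = snd (snd r) w}"
        by (rule arg_cong[where f = "measure_pmf.prob _"]) auto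
      also have "\<dots> \<le> 1 / real L21 * measure_pmf.prob PF' {F. T3 (F w') y1}"
      proof (rule prob_pair_pmf_mult_le)
        have "measure_pmf.prob R {r. snd (snd r) w' = snd (snd r) w} = measure_pmf.prob (map_pmf snd (map_pmf snd R)) {k. k w' = k w}"
          by (simp add: prob_map_pmf del: pmf.map_comp)
        also have "map_pmf snd (map_pmf snd R) = PK" by (simp add: R_def map_snd_pair_pmf del: pmf.map_comp)
        also have "measure_pmf.prob PK {k. k w' = k w} \<le> 1 / real L21"
          unfolding PK_def using w' pos by (intro hash_collision_pmf) auto
        finally show "measure_pmf.prob R {r. snd (snd r) w' = snd (snd r) w} \<le> 1 / real L21" .
      qed simp
      also have "measure_pmf.prob PF' {F. T3 (F w') y1} = measure_pmf.prob (map_pmf (\<lambda>F. F w') PF') {x. T3 x y1}"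
        by (simp add: prob_map_pmf)
      also have "map_pmf (\<lambda>F. F w') PF' = P" using w' by (simp add: PF'_def Pi_pmf_component)
      also have "1 / real L21 * measure_pmf.prob P {x. T3 x y1} \<le> 1 / real L21 * \<alpha>3"
        using T3 by (simp add: divide_right_mono)
      finally show "measure_pmf.prob (pair_pmf PF' R) {b. (j, b) \<in> {((x, y1, y2), F, G, h, k). k w' = k w \<and> T3 (F w') y1}} \<le> 1 / real L21 * \<alpha>3" .
    qed
    finally have *: "measure_pmf.prob (bind_pmf \<Omega> (\<lambda>\<omega>. map_pmf (\<lambda>(y1, y2). (\<omega>, w, y1, y2)) (K (fst \<omega> w)))) {(\<omega>, w, y1, y2). wrong \<omega> w y1 y2}
      \<le> ?c0 + real (card ?N') * \<alpha>1 + real (card ?N') * (real (card ?I) * (1 / real L12 * \<alpha>2)) + real (card ?N') * (1 / real L21 * \<alpha>3)"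
      by simp
    \<comment> \<open>The \<alpha>'s bound probabilities and are therefore nonnegative, which allows
      the number of wrong messages to be replaced by \<open>N\<close>.\<close>
    have nn: "0 \<le> \<alpha>1" "0 \<le> \<alpha>2" "0 \<le> \<alpha>3"
      using order.trans[OF measure_nonneg T1] order.trans[OF measure_nonneg T2] order.trans[OF measure_nonneg T3] by auto
    have card: "real (card ?N') \<le> real N" using card_Diff1_le[of ?N w] by simp
    have "real (card ?N') * \<alpha>1 \<le> real N * \<alpha>1"
      "real (card ?N') * (real (card ?I) * (1 / real L12 * \<alpha>2)) \<le> real N * (real (card ?I) * (1 / real L12 * \<alpha>2))"
      "real (card ?N') * (1 / real L21 * \<alpha>3) \<le> real N * (1 / real L21 * \<alpha>3)"
      by (rule mult_right_mono[OF card], use nn in simp)+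
    moreover have "real N * (real (card ?I) * (1 / real L12 * \<alpha>2)) = ?c2" "real N * (1 / real L21 * \<alpha>3) = ?c3"
      by simp_all
    ultimately show ?thesis using * by linarith
  qed
  have "measure_pmf.prob (bind_pmf (pmf_of_set ?N) (\<lambda>w. bind_pmf \<Omega> (\<lambda>\<omega>. map_pmf (\<lambda>(y1, y2). (\<omega>, w, y1, y2)) (K (fst \<omega> w)))))
     {(\<omega>, w, y1, y2). wrong \<omega> w y1 y2} \<le> ?c0 + real N * \<alpha>1 + ?c2 + ?c3"
    using pos by (intro prob_bind_pmf_le each) simp
  \<comment> \<open>The average over messages and the average over codes are exchanged, so that a
    single code can be chosen for all messages at once.\<close>
  then have "measure_pmf.prob (bind_pmf \<Omega> (\<lambda>\<omega>. bind_pmf (pmf_of_set ?N) (\<lambda>w. map_pmf (\<lambda>(y1, y2). (\<omega>, w, y1, y2)) (K (fst \<omega> w)))))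
     {(\<omega>, w, y1, y2). wrong \<omega> w y1 y2} \<le> ?c0 + real N * \<alpha>1 + ?c2 + ?c3"
    by (subst bind_commute_pmf)
  from prob_bind_pmf_le_exists[OF this] obtain \<omega> where \<omega>: "\<omega> \<in> set_pmf \<Omega>"
    and le: "measure_pmf.prob (bind_pmf (pmf_of_set ?N) (\<lambda>w. map_pmf (\<lambda>(y1, y2). (\<omega>, w, y1, y2)) (K (fst \<omega> w))))
     {(\<omega>, w, y1, y2). wrong \<omega> w y1 y2} \<le> ?c0 + real N * \<alpha>1 + ?c2 + ?c3" by blast
  obtain F G h k where \<omega>_eq: "\<omega> = (F, G, h, k)" by (metis surj_pair)
  have "bind_pmf (pmf_of_set ?N) (\<lambda>w. map_pmf (\<lambda>(y1, y2). (\<omega>, w, y1, y2)) (K (F w)))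
     = map_pmf (Pair \<omega>) (bind_pmf (pmf_of_set ?N) (\<lambda>w. map_pmf (\<lambda>(y1, y2). (w, y1, y2)) (K (F w))))"
    by (simp add: map_bind_pmf pmf.map_comp o_def case_prod_unfold)
  with le have "?err F (h12 \<omega>) (h21 \<omega>) (d1 \<omega>) (d2 \<omega>) \<le> ?c0 + real N * \<alpha>1 + ?c2 + ?c3"
    by (simp add: \<omega>_eq prob_map_pmf wrong_def case_prod_unfold)
  moreover have "?ok F (h12 \<omega>) (h21 \<omega>) (d1 \<omega>) (d2 \<omega>)"
  proof (intro conjI ballI allI)
    have F: "F \<in> set_pmf PF" and h: "h \<in> set_pmf PH" and k: "k \<in> set_pmf PK"
      using \<omega> by (simp_all add: \<Omega>_def \<omega>_eq)
    show "F w \<in> set_pmf P" if "w \<in> ?N" for w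
      using F that by (simp add: PF_def set_Pi_pmf PiE_dflt_def)
    show d2: "d2 \<omega> b y \<in> ?N" for b y unfolding d2_def \<omega>_eq prod.case by (rule unique_message_in[OF pos(1)])
    show "d1 \<omega> b y \<in> ?N" for b y unfolding d1_def \<omega>_eq prod.case by (rule unique_message_in[OF pos(1)])
    have bins: "h m \<in> {1..L12}" if "m \<in> ?I" for m
      using h that pos by (auto simp: PH_def set_Pi_pmf PiE_dflt_def set_pmf_of_set)
    show "h12 \<omega> y \<in> {1..L12}" for y
      unfolding h12_def \<omega>_eq prod.case by (rule bins[OF sel])
    have bins': "k w \<in> {1..L21}" if "w \<in> ?N" for w
      using k that pos by (auto simp: PK_def set_Pi_pmf PiE_dflt_def set_pmf_of_set)
    show "h21 \<omega> y b \<in> {1..L21}" for y b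
      using bins'[OF d2] by (simp add: h21_def \<omega>_eq)
  qed
  ultimately show ?thesis by blast
qed

section \<open>Memoryless blocks\<close>

text \<open>The logarithm of the product is a sum of independent identically distributed terms,
  bounded because the support is finite and \<rho> is positive there. Hoeffding's inequality then
  gives an exponentially small deviation probability.\<close>

lemma log_prod_concentration_pmf:
  fixes D :: "'z pmf" and \<rho> :: "'z \<Rightarrow> real"
  assumes fin: "finite (set_pmf D)" and pos: "\<And>z. z \<in> set_pmf D \<Longrightarrow> 0 < \<rho> z" and \<delta>: "0 < \<delta>"
  defines "\<mu> \<equiv> measure_pmf.expectation D (\<lambda>z. log 2 (\<rho> z))"
  shows "(\<lambda>n. measure_pmf.prob (Pi_pmf {..<n} dflt (\<lambda>_. D))
            {z. (\<Prod>i<n. \<rho> (z i)) \<le> 2 powr (real n * (\<mu> - \<delta>)) \<or> 2 powr (real n * (\<mu> + \<delta>)) \<le> (\<Prod>i<n. \<rho> (z i))})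
         \<longlonglongrightarrow> 0"
proof -
  let ?f = "\<lambda>z. log 2 (\<rho> z)"
  \<comment> \<open>The summand 1 keeps \<open>B\<close> positive even if all logarithms vanish, so
    the denominator in Hoeffding's bound is nonzero.\<close>
  define B where "B = 1 + (\<Sum>z\<in>set_pmf D. \<bar>?f z\<bar>)"
  have B: "0 < B" by (auto simp: B_def intro!: add_pos_nonneg sum_nonneg)
  have le_B: "\<bar>?f z\<bar> \<le> B" if "z \<in> set_pmf D" for z
    using member_le_sum[OF that, of "\<lambda>z. \<bar>?f z\<bar>"] fin by (simp add: B_def)
  let ?e = "\<lambda>n::nat. 2 * exp (- (\<delta>\<^sup>2 / (2 * B\<^sup>2)) * real n)"
  have bound: "measure_pmf.prob (Pi_pmf {..<n} dflt (\<lambda>_. D))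
      {z. (\<Prod>i<n. \<rho> (z i)) \<le> 2 powr (real n * (\<mu> - \<delta>)) \<or> 2 powr (real n * (\<mu> + \<delta>)) \<le> (\<Prod>i<n. \<rho> (z i))} \<le> ?e n"
    if n: "0 < n" for n
  proof -
    let ?P = "Pi_pmf {..<n} dflt (\<lambda>_. D)"
    have comp: "map_pmf (\<lambda>z. z i) ?P = D" if "i < n" for i
      using that by (simp add: Pi_pmf_component)
    have supp: "z i \<in> set_pmf D" if "z \<in> set_pmf ?P" "i < n" for z i
      using that by (auto simp: set_Pi_pmf PiE_dflt_def)
    have exp_i: "measure_pmf.expectation ?P (\<lambda>z. ?f (z i)) = \<mu>" if "i < n" for i
    proof -
      have "measure_pmf.expectation ?P (\<lambda>z. ?f (z i)) = measure_pmf.expectation (map_pmf (\<lambda>z. z i) ?P) ?f"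
        by simp
      also have "\<dots> = \<mu>" by (simp only: comp[OF that] \<mu>_def)
      finally show ?thesis .
    qed
    interpret Hoeffding_ineq "measure_pmf ?P" "{..<n}" "\<lambda>i z. ?f (z i)" "\<lambda>_. - B" "\<lambda>_. B" "real n * \<mu>"
    proof unfold_locales
      show "prob_space.indep_vars (measure_pmf ?P) (\<lambda>_. borel) (\<lambda>i z. ?f (z i)) {..<n}"
        by (rule prob_space.indep_vars_compose2[OF measure_pmf.prob_space_axioms indep_vars_Pi_pmf]) auto
      show "AE z in measure_pmf ?P. ?f (z i) \<in> {- B..B}" if "i \<in> {..<n}" for i
        using le_B supp that by (auto simp: AE_measure_pmf_iff abs_le_iff minus_le_iff)
      have "(\<Sum>i<n. measure_pmf.expectation ?P (\<lambda>z. ?f (z i))) = (\<Sum>i<n. \<mu>)"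
        by (intro sum.cong refl exp_i) auto
      then show "real n * \<mu> \<equiv> (\<Sum>i<n. measure_pmf.expectation ?P (\<lambda>z. ?f (z i)))" by simp
    qed auto
    have "measure_pmf.prob ?P
      {z. (\<Prod>i<n. \<rho> (z i)) \<le> 2 powr (real n * (\<mu> - \<delta>)) \<or> 2 powr (real n * (\<mu> + \<delta>)) \<le> (\<Prod>i<n. \<rho> (z i))}
      \<le> measure_pmf.prob ?P {z \<in> space ?P. real n * \<delta> \<le> \<bar>(\<Sum>i<n. ?f (z i)) - real n * \<mu>\<bar>}"
    proof (rule prob_pmf_mono)
      fix z assume z: "z \<in> set_pmf ?P" and
        *: "z \<in> {z. (\<Prod>i<n. \<rho> (z i)) \<le> 2 powr (real n * (\<mu> - \<delta>)) \<or> 2 powr (real n * (\<mu> + \<delta>)) \<le> (\<Prod>i<n. \<rho> (z i))}"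
      have pos_z: "0 < \<rho> (z i)" if "i < n" for i using pos supp[OF z that] .
      have "(\<Prod>i<n. \<rho> (z i)) = 2 powr (\<Sum>i<n. ?f (z i))"
        using pos_z by (simp add: powr_sum)
      with * have "(\<Sum>i<n. ?f (z i)) \<le> real n * (\<mu> - \<delta>) \<or> real n * (\<mu> + \<delta>) \<le> (\<Sum>i<n. ?f (z i))"
        by simp
      then show "z \<in> {z \<in> space ?P. real n * \<delta> \<le> \<bar>(\<Sum>i<n. ?f (z i)) - real n * \<mu>\<bar>}"
        by (auto simp: algebra_simps)
    qed
    also have "\<dots> \<le> 2 * exp (- 2 * (real n * \<delta>)\<^sup>2 / (\<Sum>i<n. (B - - B)\<^sup>2))"
      using n B \<delta> by (intro Hoeffding_ineq_abs_ge) auto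
    also have "- 2 * (real n * \<delta>)\<^sup>2 / (\<Sum>i<n. (B - - B)\<^sup>2) = - (\<delta>\<^sup>2 / (2 * B\<^sup>2)) * real n"
      using n B by (simp add: power2_eq_square field_simps)
    finally show ?thesis .
  qed
  have "(\<lambda>n::nat. 2 * exp (- \<kappa> * real n)) \<longlonglongrightarrow> 0" if "0 < \<kappa>" for \<kappa> :: real
    using that by real_asymp
  from this[of "\<delta>\<^sup>2 / (2 * B\<^sup>2)"] have lim: "?e \<longlonglongrightarrow> 0" using B \<delta> by simp
  show ?thesis
  proof (rule tendsto_sandwich[OF _ _ tendsto_const lim])
    show "\<forall>\<^sub>F n in sequentially. measure_pmf.prob (Pi_pmf {..<n} dflt (\<lambda>_. D))
      {z. (\<Prod>i<n. \<rho> (z i)) \<le> 2 powr (real n * (\<mu> - \<delta>)) \<or> 2 powr (real n * (\<mu> + \<delta>)) \<le> (\<Prod>i<n. \<rho> (z i))} \<le> ?e n"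
      using eventually_gt_at_top[of 0] by eventually_elim (rule bound)
  qed simp
qed

text \<open>Independence turns the expectation of the product into a product of expectations, each
  at most 1, and Markov's inequality finishes. The function \<open>g\<close> depends on the position
  because the letters held fixed, such as \<open>y2 i\<close> and \<open>v i\<close>, differ from
  position to position.\<close>

lemma prod_tail_bound_pmf:
  fixes D :: "'i \<Rightarrow> 'z pmf" and g :: "'i \<Rightarrow> 'z \<Rightarrow> real"
  assumes A: "finite A" and fin: "\<And>i. i \<in> A \<Longrightarrow> finite (set_pmf (D i))" and nn: "\<And>i z. 0 \<le> g i z"
    and E: "\<And>i. i \<in> A \<Longrightarrow> measure_pmf.expectation (D i) (g i) \<le> 1" and c: "0 < c"
  shows "measure_pmf.prob (Pi_pmf A dflt D) {z. c < (\<Prod>i\<in>A. g i (z i))} \<le> 1 / c"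
proof -
  let ?P = "Pi_pmf A dflt D" and ?g = "\<lambda>z. \<Prod>i\<in>A. g i (z i)"
  have finP: "finite (set_pmf ?P)"
    using A fin by (auto simp: set_Pi_pmf intro!: finite_PiE_dflt)
  have "measure_pmf.prob ?P {z. c < ?g z} \<le> measure_pmf.prob ?P {z \<in> space ?P. c \<le> ?g z}"
    by (rule prob_pmf_mono) auto
  also have "\<dots> \<le> measure_pmf.expectation ?P ?g / c"
    using finP c nn
    by (intro integral_Markov_inequality_measure[where A = "{}"] integrable_measure_pmf_finite) (auto intro!: prod_nonneg)
  also have "measure_pmf.expectation ?P ?g = (\<Prod>i\<in>A. measure_pmf.expectation (D i) (g i))"
    using A fin nn by (intro expectation_prod_Pi_pmf) (auto intro: integrable_measure_pmf_finite)
  also have "\<dots> \<le> 1"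
    using E nn by (intro prod_le_1) auto
  finally show ?thesis using c by (simp add: divide_right_mono)
qed

text \<open>
  Junk value: the ratio is \<open>0\<close> where a denominator vanishes, which keeps its expectation below 1.
  The distribution \<open>p\<close> need not be the first marginal of \<open>J\<close>.
\<close>

definition dens_ratio :: "'a pmf \<Rightarrow> ('a \<times> 'b) pmf \<Rightarrow> 'a \<Rightarrow> 'b \<Rightarrow> real" where
  "dens_ratio p J a b = pmf J (a, b) / (pmf p a * pmf (map_pmf snd J) b)"

lemma dens_ratio_nonneg: "0 \<le> dens_ratio p J a b"
  by (simp add: dens_ratio_def)

lemma dens_ratio_pos: "a \<in> set_pmf p \<Longrightarrow> (a, b) \<in> set_pmf J \<Longrightarrow> 0 < dens_ratio p J a b"
  by (auto simp: dens_ratio_def intro!: divide_pos_pos mult_pos_pos pmf_positive)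
     (metis imageI snd_conv)

text \<open>The weight \<open>pmf p a\<close> cancels against the denominator, leaving a sum of
  \<open>pmf J (a, b)\<close> over the support of \<open>p\<close> divided by the marginal at
  \<open>b\<close>. The sum is at most this marginal because the support of \<open>p\<close> may
  miss part of the fibre; a vanishing marginal gives the value 0.\<close>

lemma expectation_dens_ratio_le_1:
  assumes "finite (set_pmf p)"
  shows "measure_pmf.expectation p (\<lambda>a. dens_ratio p J a b) \<le> 1"
proof -
  let ?c = "pmf (map_pmf snd J) b"
  have "measure_pmf.expectation p (\<lambda>a. dens_ratio p J a b) = (\<Sum>a\<in>set_pmf p. dens_ratio p J a b * pmf p a)"
    using assms by (rule integral_measure_pmf_real) auto
  also have "\<dots> = (\<Sum>a\<in>set_pmf p. pmf J (a, b) / ?c)"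
    by (intro sum.cong refl) (simp add: dens_ratio_def set_pmf_iff)
  also have "\<dots> = (\<Sum>a\<in>set_pmf p. pmf J (a, b)) / ?c" by (simp add: sum_divide_distrib)
  also have "\<dots> \<le> 1"
  proof (cases "?c = 0")
    case False
    have "(\<Sum>a\<in>set_pmf p. pmf J (a, b)) = (\<Sum>z\<in>(\<lambda>a. (a, b)) ` set_pmf p. pmf J z)"
      by (subst sum.reindex) (auto simp: inj_on_def)
    also have "\<dots> = measure_pmf.prob J ((\<lambda>a. (a, b)) ` set_pmf p)"
      using assms by (simp add: measure_measure_pmf_finite)
    also have "\<dots> \<le> ?c" unfolding pmf_map by (rule prob_pmf_mono) auto
    finally have le: "(\<Sum>a\<in>set_pmf p. pmf J (a, b)) \<le> ?c" .
    moreover have "0 < ?c" using False pmf_nonneg[of "map_pmf snd J" b] by linarith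
    ultimately show ?thesis by simp
  qed simp
  finally show ?thesis .
qed

section \<open>Words as independent letters\<close>

definition single_letter ::
  "('x \<Rightarrow> ('y1 \<times> 'y2) pmf) \<Rightarrow> 'x pmf \<Rightarrow> ('y1 \<Rightarrow> 'v pmf) \<Rightarrow> ('x \<times> 'y1 \<times> 'y2 \<times> 'v) pmf" where
  "single_letter W p q = bind_pmf p (\<lambda>x. bind_pmf (W x) (\<lambda>(y1, y2). map_pmf (\<lambda>v. (x, y1, y2, v)) (q y1)))"

lemma set_Pi_pmf_words: "x \<in> set_pmf (Pi_pmf {..<n :: nat} undefined D) \<Longrightarrow> restrict x {..<n} = x"
  by (auto simp: set_Pi_pmf PiE_dflt_def fun_eq_iff restrict_def)

text \<open>Two independent words amount to one word of independent pairs. The restrictions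
  reconcile the defaults outside \<open>{..<n}\<close>, where the components of an undefined pair
  need not be \<open>undefined\<close>.\<close>

lemma pair_Pi_pmf:
  fixes n :: nat
  shows "pair_pmf (Pi_pmf {..<n} undefined (\<lambda>_. p)) (Pi_pmf {..<n} undefined (\<lambda>_. q))
   = map_pmf (\<lambda>z. (restrict (\<lambda>i. fst (z i)) {..<n}, restrict (\<lambda>i. snd (z i)) {..<n}))
       (Pi_pmf {..<n} undefined (\<lambda>_. pair_pmf p q))"
proof -
  have "Pi_pmf {..<n} undefined (\<lambda>_. pair_pmf p q) =
    bind_pmf (Pi_pmf {..<n} undefined (\<lambda>_. p)) (\<lambda>f. bind_pmf (Pi_pmf {..<n} undefined (\<lambda>_. q))
      (\<lambda>g. return_pmf (\<lambda>i. if i \<in> {..<n} then (f i, g i) else undefined)))"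
    unfolding pair_pmf_def
    by (subst Pi_pmf_bind[where d' = undefined], simp, subst Pi_pmf_bind[where d' = undefined], simp)
       (simp only: Pi_pmf_return_pmf finite_lessThan)
  then have "map_pmf (\<lambda>z. (restrict (\<lambda>i. fst (z i)) {..<n}, restrict (\<lambda>i. snd (z i)) {..<n}))
       (Pi_pmf {..<n} undefined (\<lambda>_. pair_pmf p q))
     = bind_pmf (Pi_pmf {..<n} undefined (\<lambda>_. p)) (\<lambda>f. bind_pmf (Pi_pmf {..<n} undefined (\<lambda>_. q))
      (\<lambda>g. return_pmf (restrict f {..<n}, restrict g {..<n})))"
    by (simp add: map_bind_pmf restrict_def if_distrib cong: if_cong)
  also have "\<dots> = pair_pmf (Pi_pmf {..<n} undefined (\<lambda>_. p)) (Pi_pmf {..<n} undefined (\<lambda>_. q))"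
    unfolding pair_pmf_def by (rule bind_pmf_cong[OF refl], rule bind_pmf_cong[OF refl]) (simp add: set_Pi_pmf_words)
  finally show ?thesis ..
qed

text \<open>\<open>Pi_pmf_bind\<close> pushes the product through each of the three draws, since
  every position evolves separately. The law of the coding words thereby becomes a product of
  \<open>single_letter\<close> laws, to which the concentration bound applies.\<close>

lemma block_joint_pmf:
  "bind_pmf (Pi_pmf {..<n} undefined (\<lambda>_. p)) (\<lambda>x. bind_pmf (channel_block W n x) (\<lambda>(y1, y2).
     map_pmf (\<lambda>v. (x, y1, y2, v)) (Pi_pmf {..<n} undefined (\<lambda>i. q (y1 i)))))
   = map_pmf (\<lambda>z. (restrict (\<lambda>i. fst (z i)) {..<n}, restrict (\<lambda>i. fst (snd (z i))) {..<n},
        restrict (\<lambda>i. fst (snd (snd (z i)))) {..<n}, restrict (\<lambda>i. snd (snd (snd (z i)))) {..<n}))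
       (Pi_pmf {..<n} undefined (\<lambda>_. single_letter W p q))"
proof -
  let ?Pi = "\<lambda>D. Pi_pmf {..<n} undefined D"
  have "?Pi (\<lambda>_. single_letter W p q) =
    bind_pmf (?Pi (\<lambda>_. p)) (\<lambda>f. bind_pmf (?Pi (\<lambda>i. W (f i))) (\<lambda>g. bind_pmf (?Pi (\<lambda>i. q (fst (g i))))
      (\<lambda>h. return_pmf (\<lambda>i. if i \<in> {..<n} then (f i, fst (g i), snd (g i), h i) else undefined))))"
    unfolding single_letter_def map_pmf_def case_prod_unfold
    by (subst Pi_pmf_bind[where d' = undefined], simp, subst Pi_pmf_bind[where d' = undefined], simp,
        subst Pi_pmf_bind[where d' = undefined], simp)
       (simp only: Pi_pmf_return_pmf finite_lessThan)
  then have "map_pmf (\<lambda>z. (restrict (\<lambda>i. fst (z i)) {..<n}, restrict (\<lambda>i. fst (snd (z i))) {..<n},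
        restrict (\<lambda>i. fst (snd (snd (z i)))) {..<n}, restrict (\<lambda>i. snd (snd (snd (z i)))) {..<n}))
       (?Pi (\<lambda>_. single_letter W p q))
    = bind_pmf (?Pi (\<lambda>_. p)) (\<lambda>f. bind_pmf (?Pi (\<lambda>i. W (f i))) (\<lambda>g. bind_pmf (?Pi (\<lambda>i. q (fst (g i))))
      (\<lambda>h. return_pmf (restrict f {..<n}, restrict (\<lambda>i. fst (g i)) {..<n}, restrict (\<lambda>i. snd (g i)) {..<n}, restrict h {..<n}))))"
    by (simp add: map_bind_pmf restrict_def if_distrib cong: if_cong)
  also have "\<dots> = bind_pmf (?Pi (\<lambda>_. p)) (\<lambda>f. bind_pmf (?Pi (\<lambda>i. W (f i))) (\<lambda>g. bind_pmf (?Pi (\<lambda>i. q (fst (g i))))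
      (\<lambda>h. return_pmf (f, restrict (\<lambda>i. fst (g i)) {..<n}, restrict (\<lambda>i. snd (g i)) {..<n}, h))))"
    by (rule bind_pmf_cong[OF refl], rule bind_pmf_cong[OF refl], rule bind_pmf_cong[OF refl]) (simp add: set_Pi_pmf_words)
  \<comment> \<open>The test channel reads only positions below \<open>n\<close>, so it does not
    notice whether \<open>y1\<close> has been restricted.\<close>
  also have "\<dots> = bind_pmf (?Pi (\<lambda>_. p)) (\<lambda>f. bind_pmf (?Pi (\<lambda>i. W (f i))) (\<lambda>g.
      bind_pmf (?Pi (\<lambda>i. q (restrict (\<lambda>i. fst (g i)) {..<n} i)))
      (\<lambda>h. return_pmf (f, restrict (\<lambda>i. fst (g i)) {..<n}, restrict (\<lambda>i. snd (g i)) {..<n}, h))))"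
    by (rule bind_pmf_cong[OF refl], rule bind_pmf_cong[OF refl], rule bind_pmf_cong[OF _ refl], rule Pi_pmf_cong) auto
  also have "\<dots> = bind_pmf (Pi_pmf {..<n} undefined (\<lambda>_. p)) (\<lambda>x. bind_pmf (channel_block W n x) (\<lambda>(y1, y2).
     map_pmf (\<lambda>v. (x, y1, y2, v)) (Pi_pmf {..<n} undefined (\<lambda>i. q (y1 i)))))"
    by (simp only: channel_block_def bind_map_pmf prod.case map_pmf_def)
       (simp only: bind_assoc_pmf bind_return_pmf prod.case)
  finally show ?thesis ..
qed

section \<open>Coding over blocks at a fixed rate\<close>

definition message_count :: "nat \<Rightarrow> real \<Rightarrow> nat" where
  "message_count n r = nat \<lfloor>2 powr (real n * r)\<rfloor>"

lemma messages_eq: "messages n r = {1..message_count n r}"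
  by (simp add: messages_def message_count_def)

text \<open>Rounding down loses at most a factor 2, because \<open>2 powr (real n * r)\<close> is at
  least 1 for nonnegative \<open>r\<close>.\<close>

lemma message_count_bounds:
  assumes "0 \<le> r"
  shows "0 < message_count n r" "real (message_count n r) \<le> 2 powr (real n * r)"
    "2 powr (real n * r) \<le> 2 * real (message_count n r)"
proof -
  have "(1::real) \<le> 2 powr (real n * r)" using assms by (simp add: ge_one_powr_ge_zero)
  then have "1 \<le> \<lfloor>2 powr (real n * r)\<rfloor>" by (simp add: le_floor_iff)
  then have eq: "real (message_count n r) = of_int \<lfloor>2 powr (real n * r)\<rfloor>" and "1 \<le> real (message_count n r)"
    by (simp_all add: message_count_def)
  from this(2) show "0 < message_count n r" by (rule contrapos_pp) simp
  show "real (message_count n r) \<le> 2 powr (real n * r)" unfolding eq by linarith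
  have "2 powr (real n * r) < real (message_count n r) + 1" unfolding eq by linarith
  then show "2 powr (real n * r) \<le> 2 * real (message_count n r)"
    using \<open>1 \<le> real (message_count n r)\<close> by linarith
qed

lemma set_single_letter:
  "(x, y1, y2, v) \<in> set_pmf (single_letter W p q) \<longleftrightarrow> x \<in> set_pmf p \<and> (y1, y2) \<in> set_pmf (W x) \<and> v \<in> set_pmf (q y1)"
  by (force simp: single_letter_def)

text \<open>The expectations are information quantities: \<open>I0\<close> is I(Y1;V),
  \<open>I1\<close> is I(X;Y2,V), \<open>I2\<close> is I(X;Y2) + I(V;X,Y2), and \<open>I3\<close> is
  I(X;Y1). The quantization codebook has rate slightly above \<open>I0\<close>; a wrong message with
  a wrong word passes with exponent \<open>I2\<close>, and the hash contributes the further exponent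
  \<open>C12\<close>.\<close>

lemma reliable_first_12:
  fixes W :: "'x::finite \<Rightarrow> ('y1::finite \<times> 'y2::finite) pmf" and p :: "'x pmf" and q :: "'y1 \<Rightarrow> 'v pmf"
  assumes fin: "\<And>y. finite (set_pmf (q y))"
  defines "j \<equiv> single_letter W p q"
  defines "pv \<equiv> map_pmf (\<lambda>(x, y1, y2, v). v) j"
  defines "r0 \<equiv> \<lambda>y1 v. pmf (q y1) v / pmf pv v"
    and "r1 \<equiv> \<lambda>x y2 v. dens_ratio p (map_pmf (\<lambda>(x, y1, y2, v). (x, y2, v)) j) x (y2, v)"
    and "r2 \<equiv> \<lambda>x y2 v. dens_ratio (pair_pmf p pv) (map_pmf (\<lambda>(x, y1, y2, v). ((x, v), y2)) j) (x, v) y2"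
    and "r3 \<equiv> \<lambda>x y1. dens_ratio p (map_pmf (\<lambda>(x, y1, y2, v). (x, y1)) j) x y1"
  defines "I0 \<equiv> measure_pmf.expectation j (\<lambda>(x, y1, y2, v). log 2 (r0 y1 v))"
    and "I1 \<equiv> measure_pmf.expectation j (\<lambda>(x, y1, y2, v). log 2 (r1 x y2 v))"
    and "I2 \<equiv> measure_pmf.expectation j (\<lambda>(x, y1, y2, v). log 2 (r2 x y2 v))"
    and "I3 \<equiv> measure_pmf.expectation j (\<lambda>(x, y1, y2, v). log 2 (r3 x y1))"
  assumes C: "0 \<le> C12" "0 \<le> C21" and R: "0 \<le> R" and I0: "0 \<le> I0"
    and gaps: "R < I1" "R < I2 - I0 + C12" "R < I3 + C21"
  shows "reliable_codes W C12 C21 (\<lambda>_. R)"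
proof -
  \<comment> \<open>A quarter of the smallest gap suffices for the tightest constraint: the codebook
    rate takes 2 \<delta>, the threshold takes one, and one is left for exponential decay.\<close>
  define \<delta> where "\<delta> = min (I1 - R) (min (I2 - I0 + C12 - R) (I3 + C21 - R)) / 4"
  have \<delta>: "0 < \<delta>" using gaps by (simp add: \<delta>_def)
  have \<delta>1: "R - (I1 - \<delta>) \<le> - \<delta>" and \<delta>2: "R + (I0 + 2 * \<delta>) - (I2 - \<delta>) - C12 \<le> - \<delta>"
    and \<delta>3: "R - (I3 - \<delta>) - C21 \<le> - \<delta>"
    using gaps by (simp_all add: \<delta>_def min_def field_simps split: if_splits)
  have finj: "finite (set_pmf j)" by (auto simp: j_def single_letter_def fin)
  have finp: "finite (set_pmf p)" by simp
  have finpv: "finite (set_pmf pv)" using finj by (simp add: pv_def)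
  have pv_in: "v \<in> set_pmf pv" if "(x, y1, y2, v) \<in> set_pmf j" for x y1 y2 v
    using that by (force simp: pv_def)
  have p_in: "x \<in> set_pmf p" if "(x, y1, y2, v) \<in> set_pmf j" for x y1 y2 v
    using that by (simp add: j_def set_single_letter)
  have pos0: "0 < r0 y1 v" if "(x, y1, y2, v) \<in> set_pmf j" for x y1 y2 v
    using pv_in[OF that] that by (auto simp: r0_def j_def set_single_letter pmf_positive)
  have pos1: "0 < r1 x y2 v" if "(x, y1, y2, v) \<in> set_pmf j" for x y1 y2 v
    using p_in[OF that] that unfolding r1_def by (intro dens_ratio_pos) force+
  have pos2: "0 < r2 x y2 v" if "(x, y1, y2, v) \<in> set_pmf j" for x y1 y2 v
    using p_in[OF that] pv_in[OF that] that unfolding r2_def by (intro dens_ratio_pos) force+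
  have pos3: "0 < r3 x y1" if "(x, y1, y2, v) \<in> set_pmf j" for x y1 y2 v
    using p_in[OF that] that unfolding r3_def by (intro dens_ratio_pos) force+
  let ?Z = "\<lambda>n. Pi_pmf {..<n} (undefined :: 'x \<times> 'y1 \<times> 'y2 \<times> 'v) (\<lambda>_. j)"
  define atyp where "atyp \<rho> n = measure_pmf.prob (?Z n)
      {z. (\<Prod>i<n. \<rho> (z i)) \<le> 2 powr (real n * (measure_pmf.expectation j (\<lambda>z. log 2 (\<rho> z)) - \<delta>))
        \<or> 2 powr (real n * (measure_pmf.expectation j (\<lambda>z. log 2 (\<rho> z)) + \<delta>)) \<le> (\<Prod>i<n. \<rho> (z i))}" for \<rho> n
  let ?\<rho>0 = "\<lambda>(x, y1, y2, v). r0 y1 v" and ?\<rho>1 = "\<lambda>(x, y1, y2, v). r1 x y2 v"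
    and ?\<rho>2 = "\<lambda>(x, y1, y2, v). r2 x y2 v" and ?\<rho>3 = "\<lambda>(x, y1, y2, v). r3 x y1"
  have lim: "atyp ?\<rho>0 \<longlonglongrightarrow> 0" "atyp ?\<rho>1 \<longlonglongrightarrow> 0" "atyp ?\<rho>2 \<longlonglongrightarrow> 0" "atyp ?\<rho>3 \<longlonglongrightarrow> 0"
    unfolding atyp_def
    by (rule log_prod_concentration_pmf[OF finj _ \<delta>]; use pos0 pos1 pos2 pos3 in force)+
  have I_eq: "measure_pmf.expectation j (\<lambda>z. log 2 (?\<rho>0 z)) = I0" "measure_pmf.expectation j (\<lambda>z. log 2 (?\<rho>1 z)) = I1"
    "measure_pmf.expectation j (\<lambda>z. log 2 (?\<rho>2 z)) = I2" "measure_pmf.expectation j (\<lambda>z. log 2 (?\<rho>3 z)) = I3"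
    unfolding I0_def I1_def I2_def I3_def by (simp_all add: case_prod_unfold)
  define \<epsilon> where "\<epsilon> n = atyp ?\<rho>1 n + atyp ?\<rho>2 n + atyp ?\<rho>3 n" for n
  have \<epsilon>_nn: "0 \<le> \<epsilon> n" for n by (simp add: \<epsilon>_def atyp_def)
  \<comment> \<open>With \<open>s\<close> near \<open>sqrt (\<epsilon> n)\<close>, the terms
    \<open>\<epsilon> n / s\<close> and \<open>s\<close> each cost about one square root;
    \<open>1 / real (Suc n)\<close> keeps \<open>s\<close> positive when \<open>\<epsilon> n\<close>
    is 0. The 7 is 1 + 4 + 2: rounding the codebook size up and each link alphabet down costs a
    factor 2 wherever it occurs.\<close>
  define bound where "bound n = atyp ?\<rho>0 n + (2 * sqrt (\<epsilon> n) + 1 / real (Suc n)) + exp (- (2 powr (real n * \<delta>)))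
     + 7 * 2 powr (- real n * \<delta>)" for n
  have bound_lim: "bound \<longlonglongrightarrow> 0"
  proof -
    have "(\<lambda>n. \<epsilon> n) \<longlonglongrightarrow> 0 + 0 + 0" unfolding \<epsilon>_def by (intro tendsto_add lim)
    then have "(\<lambda>n. sqrt (\<epsilon> n)) \<longlonglongrightarrow> 0" using tendsto_real_sqrt[of \<epsilon> 0] by simp
    moreover have "(\<lambda>n. exp (- (2 powr (real n * \<delta>)))) \<longlonglongrightarrow> 0" using \<delta> by real_asymp
    moreover have "(\<lambda>n. 7 * 2 powr (- real n * \<delta>)) \<longlonglongrightarrow> 0" using \<delta> by real_asymp
    moreover have "(\<lambda>n. 1 / real (Suc n)) \<longlonglongrightarrow> 0" by real_asymp
    ultimately have "bound \<longlonglongrightarrow> 0 + (2 * 0 + 0) + 0 + 0"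
      unfolding bound_def using lim(1) by (intro tendsto_add tendsto_mult tendsto_const)
    then show ?thesis by simp
  qed
  have code: "\<exists>c. is_code C12 C21 n R c \<and> error_prob W n R c \<le> bound n" for n
  proof -
    let ?P = "Pi_pmf {..<n} undefined (\<lambda>_. p)" and ?PV = "Pi_pmf {..<n} undefined (\<lambda>_. pv)"
      and ?Q = "\<lambda>y1. Pi_pmf {..<n} undefined (\<lambda>i. q (y1 i))"
    let ?N = "message_count n R" and ?L12 = "message_count n C12" and ?L21 = "message_count n C21"
    \<comment> \<open>The codebook rate exceeds the covering threshold \<open>I0 + \<delta>\<close>
      by \<delta>, so the ratio of \<open>M\<close> to \<open>?t\<close> is at least
      \<open>2 powr (real n * \<delta>)\<close> and the chance of failed covering decays doubly
      exponentially.\<close>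
    define M where "M = nat \<lceil>2 powr (real n * (I0 + 2 * \<delta>))\<rceil>"
    have M_le: "real M \<le> 2 * 2 powr (real n * (I0 + 2 * \<delta>))" and M_ge: "2 powr (real n * (I0 + 2 * \<delta>)) \<le> real M"
    proof -
      have "(1::real) \<le> 2 powr (real n * (I0 + 2 * \<delta>))" using I0 \<delta> by (simp add: ge_one_powr_ge_zero)
      moreover have "real M = of_int \<lceil>2 powr (real n * (I0 + 2 * \<delta>))\<rceil>"
        unfolding M_def by (rule of_nat_nat) (simp add: less_le_trans[of "-1" 0])
      ultimately show "real M \<le> 2 * 2 powr (real n * (I0 + 2 * \<delta>))" "2 powr (real n * (I0 + 2 * \<delta>)) \<le> real M"
        by linarith+
    qed
    have "0 < real M" using M_ge by (rule less_le_trans[rotated]) simp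
    then have M_pos: "0 < M" by simp
    let ?t = "2 powr (real n * (I0 + \<delta>))" and ?s = "sqrt (\<epsilon> n) + 1 / real (Suc n)"
    let ?a1 = "2 powr (real n * (I1 - \<delta>))" and ?a2 = "2 powr (real n * (I2 - \<delta>))" and ?a3 = "2 powr (real n * (I3 - \<delta>))"
    define T1 where "T1 x y2 v \<longleftrightarrow> ?a1 < (\<Prod>i<n. r1 (x i) (y2 i) (v i))" for x :: "nat \<Rightarrow> 'x" and y2 v
    define T2 where "T2 x y2 v \<longleftrightarrow> ?a2 < (\<Prod>i<n. r2 (x i) (y2 i) (v i))" for x :: "nat \<Rightarrow> 'x" and y2 v
    define T3 where "T3 x y1 \<longleftrightarrow> ?a3 < (\<Prod>i<n. r3 (x i) (y1 i))" for x :: "nat \<Rightarrow> 'x" and y1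
    define r where "r y1 v = (\<Prod>i<n. r0 (y1 i) (v i))" for y1 v
    define JQ where "JQ = bind_pmf ?P (\<lambda>x. bind_pmf (channel_block W n x) (\<lambda>(y1, y2). map_pmf (\<lambda>v. (x, y1, y2, v)) (?Q y1)))"
    \<comment> \<open>For a \<open>v\<close> that is \<open>undefined\<close> outside
      \<open>{..<n}\<close> the two sides agree letter by letter: either
      \<open>pmf (q (y1 i)) (v i)\<close> is 0 and both sides vanish, or \<open>v i\<close> is in
      the support of \<open>pv\<close> and the quotient cancels. Any other \<open>v\<close> has
      probability 0.\<close>
    have dom: "pmf (?Q y1) v \<le> r y1 v * pmf ?PV v"
      if x: "x \<in> set_pmf ?P" and y: "(y1, y2) \<in> set_pmf (channel_block W n x)" for x y1 y2 v
    proof (cases "\<forall>i. i \<notin> {..<n} \<longrightarrow> v i = undefined")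
      case True
      have "pmf (q (y1 i)) (v i) = r0 (y1 i) (v i) * pmf pv (v i)" if i: "i < n" for i
      proof -
        have "x i \<in> set_pmf p" using x i by (auto simp: set_Pi_pmf PiE_dflt_def)
        moreover have "(y1 i, y2 i) \<in> set_pmf (W (x i))"
          using y i by (auto simp: channel_block_def set_Pi_pmf PiE_dflt_def)
        ultimately have "v i \<in> set_pmf (q (y1 i)) \<Longrightarrow> v i \<in> set_pmf pv"
          by (intro pv_in[of "x i" "y1 i" "y2 i"]) (simp add: j_def set_single_letter)
        then show ?thesis by (auto simp: r0_def set_pmf_iff)
      qed
      then show ?thesis using True
        by (simp add: pmf_Pi r_def prod.distrib[symmetric])
    next
      case False
      then show ?thesis by (auto simp: pmf_Pi)
    qed
    have T1_le: "measure_pmf.prob ?P {x. T1 x y2 v} \<le> 1 / ?a1" for y2 v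
      unfolding T1_def r1_def
      by (intro prod_tail_bound_pmf expectation_dens_ratio_le_1 dens_ratio_nonneg) auto
    have T3_le: "measure_pmf.prob ?P {x. T3 x y1} \<le> 1 / ?a3" for y1
      unfolding T3_def r3_def
      by (intro prod_tail_bound_pmf expectation_dens_ratio_le_1 dens_ratio_nonneg) auto
    have T2_le: "measure_pmf.prob (pair_pmf ?P ?PV) {(x, v). T2 x y2 v} \<le> 1 / ?a2" for y2
    proof -
      let ?g = "\<lambda>i a. dens_ratio (pair_pmf p pv) (map_pmf (\<lambda>(x, y1, y2, v). ((x, v), y2)) j) a (y2 i)"
      have "measure_pmf.prob (pair_pmf ?P ?PV) {(x, v). T2 x y2 v}
        = measure_pmf.prob (Pi_pmf {..<n} undefined (\<lambda>_. pair_pmf p pv)) {z. ?a2 < (\<Prod>i<n. ?g i (z i))}"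
        unfolding pair_Pi_pmf prob_map_pmf T2_def r2_def by simp
      also have "\<dots> \<le> 1 / ?a2"
        by (intro prod_tail_bound_pmf expectation_dens_ratio_le_1 dens_ratio_nonneg) (auto simp: finpv)
      finally show ?thesis .
    qed
    have s_pos: "0 < ?s" using \<epsilon>_nn[of n] by (intro add_nonneg_pos) auto
    let ?err = "measure_pmf.prob JQ {(x, y1, y2, v). ?t < r y1 v}
      + measure_pmf.prob JQ {(x, y1, y2, v). \<not> (T1 x y2 v \<and> T2 x y2 v \<and> T3 x y1)} / ?s
      + ?s + exp (- real M / ?t) + real ?N * (1 / ?a1) + real ?N * real M * (1 / ?a2) / real ?L12 + real ?N * (1 / ?a3) / real ?L21"
    have "\<exists>enc h12 h21 d1 d2. ((\<forall>w\<in>messages n R. enc w \<in> set_pmf ?P) \<and> (\<forall>y. h12 y \<in> messages n C12) \<and>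
      (\<forall>y b. h21 y b \<in> messages n C21) \<and> (\<forall>b y. d1 b y \<in> messages n R) \<and> (\<forall>b y. d2 b y \<in> messages n R)) \<and>
      measure_pmf.prob (bind_pmf (pmf_of_set (messages n R)) (\<lambda>w. map_pmf (\<lambda>(y1, y2). (w, y1, y2)) (channel_block W n (enc w))))
        {(w, y1, y2). d1 (h21 y2 (h12 y1)) y1 \<noteq> w \<or> d2 (h12 y1) y2 \<noteq> w} \<le> ?err"
      unfolding JQ_def messages_eq
      by (rule one_shot_conference[of ?P "channel_block W n" ?Q r ?PV T1 _ T2 _ T3, OF dom T1_le T2_le T3_le])
         (use s_pos M_pos message_count_bounds(1) R C in auto)
    then obtain enc h12 h21 d1 d2 where
      enc: "\<forall>w\<in>messages n R. enc w \<in> set_pmf ?P" and h12: "\<forall>y. h12 y \<in> messages n C12"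
      and h21: "\<forall>y b. h21 y b \<in> messages n C21" and d1: "\<forall>b y. d1 b y \<in> messages n R" and d2: "\<forall>b y. d2 b y \<in> messages n R"
      and err: "measure_pmf.prob (bind_pmf (pmf_of_set (messages n R)) (\<lambda>w. map_pmf (\<lambda>(y1, y2). (w, y1, y2)) (channel_block W n (enc w))))
        {(w, y1, y2). d1 (h21 y2 (h12 y1)) y1 \<noteq> w \<or> d2 (h12 y1) y2 \<noteq> w} \<le> ?err"
      by (elim exE conjE) (rule that)
    define c where "c = \<lparr>encoder = enc, conf = First12 h12 h21, decoder1 = d1, decoder2 = d2\<rparr>"
    have "enc w \<in> words n" if "w \<in> messages n R" for w
      using bspec[OF enc that] by (auto simp: words_def set_Pi_pmf PiE_dflt_def PiE_def extensional_def)
    moreover have "is_conference n C12 C21 (conf c) \<and> decoder1 c \<in> messages n C21 \<rightarrow> words n \<rightarrow> messages n R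
        \<and> decoder2 c \<in> messages n C12 \<rightarrow> words n \<rightarrow> messages n R"
      using h12 h21 d1 d2 by (simp add: c_def)
    ultimately have "is_code C12 C21 n R c"
      unfolding is_code_def using C R by (auto simp: c_def)
    moreover have "error_prob W n R c \<le> ?err"
      using err by (simp add: error_prob_def c_def)
    moreover have "?err \<le> bound n"
    proof -
      have JQ: "JQ = map_pmf (\<lambda>z. (restrict (\<lambda>i. fst (z i)) {..<n}, restrict (\<lambda>i. fst (snd (z i))) {..<n},
        restrict (\<lambda>i. fst (snd (snd (z i)))) {..<n}, restrict (\<lambda>i. snd (snd (snd (z i)))) {..<n})) (?Z n)"
        unfolding JQ_def j_def by (rule block_joint_pmf)
      have e0: "measure_pmf.prob JQ {(x, y1, y2, v). ?t < r y1 v} \<le> atyp ?\<rho>0 n"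
        unfolding JQ prob_map_pmf atyp_def I_eq
        by (rule prob_pmf_mono) (simp add: r_def case_prod_unfold)
      have "measure_pmf.prob JQ {(x, y1, y2, v). \<not> (T1 x y2 v \<and> T2 x y2 v \<and> T3 x y1)}
        \<le> measure_pmf.prob (?Z n) ({z. (\<Prod>i<n. ?\<rho>1 (z i)) \<le> ?a1} \<union> {z. (\<Prod>i<n. ?\<rho>2 (z i)) \<le> ?a2} \<union> {z. (\<Prod>i<n. ?\<rho>3 (z i)) \<le> ?a3})"
        unfolding JQ prob_map_pmf
        by (rule prob_pmf_mono) (auto simp: T1_def T2_def T3_def case_prod_unfold not_less)
      also have "\<dots> \<le> measure_pmf.prob (?Z n) {z. (\<Prod>i<n. ?\<rho>1 (z i)) \<le> ?a1} + measure_pmf.prob (?Z n) {z. (\<Prod>i<n. ?\<rho>2 (z i)) \<le> ?a2}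
          + measure_pmf.prob (?Z n) {z. (\<Prod>i<n. ?\<rho>3 (z i)) \<le> ?a3}"
        by (rule order.trans[OF prob_pmf_Un]) (intro add_right_mono prob_pmf_Un)
      also have "\<dots> \<le> \<epsilon> n"
        unfolding \<epsilon>_def atyp_def I_eq by (intro add_mono prob_pmf_mono) auto
      finally have e1: "measure_pmf.prob JQ {(x, y1, y2, v). \<not> (T1 x y2 v \<and> T2 x y2 v \<and> T3 x y1)} \<le> \<epsilon> n" .
      have "\<epsilon> n = sqrt (\<epsilon> n) * sqrt (\<epsilon> n)" using \<epsilon>_nn[of n] by simp
      also have "\<dots> \<le> sqrt (\<epsilon> n) * ?s" using \<epsilon>_nn[of n] by (intro mult_left_mono) auto
      finally have "measure_pmf.prob JQ {(x, y1, y2, v). \<not> (T1 x y2 v \<and> T2 x y2 v \<and> T3 x y1)} / ?s \<le> sqrt (\<epsilon> n)"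
        using e1 s_pos by (simp add: divide_le_eq)
      moreover have "exp (- real M / ?t) \<le> exp (- (2 powr (real n * \<delta>)))"
      proof -
        have "2 powr (real n * \<delta>) * ?t = 2 powr (real n * (I0 + 2 * \<delta>))"
          by (simp add: powr_add[symmetric] algebra_simps)
        with M_ge have "2 powr (real n * \<delta>) \<le> real M / ?t" by (simp add: pos_le_divide_eq)
        then show ?thesis by simp
      qed
      moreover have small: "2 powr (real n * e) \<le> 2 powr (- real n * \<delta>)" if "e \<le> - \<delta>" for e
      proof -
        have "real n * e \<le> real n * (- \<delta>)" using that by (intro mult_left_mono) auto
        then show ?thesis by simp
      qed
      note N_le = message_count_bounds(2)[OF R, of n]
      have "real ?N * (1 / ?a1) \<le> 2 powr (- real n * \<delta>)"
      proof -
        have "real ?N * (1 / ?a1) \<le> 2 powr (real n * R) * (1 / ?a1)"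
          using N_le by (intro mult_right_mono) auto
        also have "\<dots> = 2 powr (real n * (R - (I1 - \<delta>)))"
          by (simp add: powr_diff[symmetric] right_diff_distrib)
        also have "\<dots> \<le> 2 powr (- real n * \<delta>)" by (rule small[OF \<delta>1])
        finally show ?thesis .
      qed
      moreover have "real ?N * real M * (1 / ?a2) / real ?L12 \<le> 4 * 2 powr (- real n * \<delta>)"
      proof -
        have "real ?N * real M * (1 / ?a2) / real ?L12
          \<le> 2 powr (real n * R) * (2 * 2 powr (real n * (I0 + 2 * \<delta>))) * (1 / ?a2) / (2 powr (real n * C12) / 2)"
          using message_count_bounds(3)[OF C(1), of n] by (intro frac_le mult_mono N_le M_le) auto
        also have "\<dots> = 4 * 2 powr (real n * R + real n * (I0 + 2 * \<delta>) - real n * (I2 - \<delta>) - real n * C12)"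
          by (simp add: powr_diff powr_add del: distrib_left_numeral)
        also have "\<dots> = 4 * 2 powr (real n * (R + (I0 + 2 * \<delta>) - (I2 - \<delta>) - C12))"
          by (simp add: algebra_simps)
        also have "\<dots> \<le> 4 * 2 powr (- real n * \<delta>)" using small[OF \<delta>2] by simp
        finally show ?thesis .
      qed
      moreover have "real ?N * (1 / ?a3) / real ?L21 \<le> 2 * 2 powr (- real n * \<delta>)"
      proof -
        have "real ?N * (1 / ?a3) / real ?L21 \<le> 2 powr (real n * R) * (1 / ?a3) / (2 powr (real n * C21) / 2)"
          using message_count_bounds(3)[OF C(2), of n] by (intro frac_le mult_mono N_le) auto
        also have "\<dots> = 2 * 2 powr (real n * R - real n * (I3 - \<delta>) - real n * C21)"
          by (simp add: powr_diff)
        also have "\<dots> = 2 * 2 powr (real n * (R - (I3 - \<delta>) - C21))"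
          by (simp add: algebra_simps)
        also have "\<dots> \<le> 2 * 2 powr (- real n * \<delta>)" using small[OF \<delta>3] by simp
        finally show ?thesis .
      qed
      ultimately show ?thesis using e0 unfolding bound_def by linarith
    qed
    ultimately show ?thesis by (intro exI[of _ c]) auto
  qed
  then obtain c where c: "\<And>n. is_code C12 C21 n R (c n)" "\<And>n. error_prob W n R (c n) \<le> bound n" by metis
  have "(\<lambda>n. error_prob W n R (c n)) \<longlonglongrightarrow> 0"
  proof (rule tendsto_sandwich[OF _ _ tendsto_const bound_lim])
    show "\<forall>\<^sub>F n in sequentially. 0 \<le> error_prob W n R (c n)" by (simp add: error_prob_def)
    show "\<forall>\<^sub>F n in sequentially. error_prob W n R (c n) \<le> bound n" using c(2) by simp
  qed
  then show ?thesis unfolding reliable_codes_def using c(1) by blast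
qed

section \<open>Single-letter identities\<close>

text \<open>For finite support this is minus the entropy of \<open>f\<close> in bits. Writing every
  information measure as a combination of this one functional reduces the identities between them to
  linear arithmetic.\<close>

definition log_lik :: "'w pmf \<Rightarrow> ('w \<Rightarrow> 'a) \<Rightarrow> real" where
  "log_lik P f = measure_pmf.expectation P (\<lambda>\<omega>. log 2 (pmf (map_pmf f P) (f \<omega>)))"

lemma log_lik_map: "log_lik (map_pmf g P) f = log_lik P (\<lambda>\<omega>. f (g \<omega>))"
  by (simp add: log_lik_def pmf.map_comp o_def)

lemma log_lik_inj: "inj h \<Longrightarrow> log_lik P (\<lambda>\<omega>. h (f \<omega>)) = log_lik P f"
proof -
  assume "inj h"
  moreover have "map_pmf (\<lambda>\<omega>. h (f \<omega>)) P = map_pmf h (map_pmf f P)" by (simp add: pmf.map_comp o_def)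
  ultimately show ?thesis by (simp add: log_lik_def pmf_map_inj' del: pmf.map_comp)
qed

lemma pmf_map_pos: "\<omega> \<in> set_pmf P \<Longrightarrow> 0 < pmf (map_pmf f P) (f \<omega>)"
  by (auto intro!: pmf_positive)

text \<open>The chain rule of entropy, with the conditional law given as an explicit kernel. Two
  choices of \<open>f\<close> whose kernels both read only the letter \<open>y1\<close> share the
  last summand, and this is how the Markov property is expressed.\<close>

lemma log_lik_add_kernel:
  assumes fin: "finite (set_pmf P)"
    and k: "map_pmf (\<lambda>\<omega>. (f \<omega>, v \<omega>)) P = bind_pmf (map_pmf f P) (\<lambda>a. map_pmf (Pair a) (k a))"
  shows "log_lik P (\<lambda>\<omega>. (f \<omega>, v \<omega>)) = log_lik P f + measure_pmf.expectation P (\<lambda>\<omega>. log 2 (pmf (k (f \<omega>)) (v \<omega>)))"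
proof -
  have pmf_k: "pmf (map_pmf (\<lambda>\<omega>. (f \<omega>, v \<omega>)) P) (a, b) = pmf (map_pmf f P) a * pmf (k a) b" for a b
  proof -
    have "pmf (map_pmf (Pair a') (k a')) (a, b) = pmf (k a) b * indicator {a} a'" for a'
    proof (cases "a' = a")
      case True
      then show ?thesis using pmf_map_inj'[of "Pair a" "k a" b] by (simp add: inj_on_def)
    next
      case False
      then have "(a, b) \<notin> set_pmf (map_pmf (Pair a') (k a'))" by auto
      then show ?thesis using False unfolding pmf_eq_0_set_pmf[symmetric] by simp
    qed
    then show ?thesis by (simp add: k pmf_bind measure_pmf_single mult.commute)
  qed
  have "log_lik P (\<lambda>\<omega>. (f \<omega>, v \<omega>)) = measure_pmf.expectation P
      (\<lambda>\<omega>. log 2 (pmf (map_pmf f P) (f \<omega>)) + log 2 (pmf (k (f \<omega>)) (v \<omega>)))"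
    unfolding log_lik_def
  proof (intro integral_cong_AE)
    show "AE \<omega> in measure_pmf P. log 2 (pmf (map_pmf (\<lambda>\<omega>. (f \<omega>, v \<omega>)) P) (f \<omega>, v \<omega>)) =
      log 2 (pmf (map_pmf f P) (f \<omega>)) + log 2 (pmf (k (f \<omega>)) (v \<omega>))"
    proof (unfold AE_measure_pmf_iff, intro ballI)
      fix \<omega> assume \<omega>: "\<omega> \<in> set_pmf P"
      have "0 < pmf (map_pmf (\<lambda>\<omega>. (f \<omega>, v \<omega>)) P) (f \<omega>, v \<omega>)" using \<omega> by (rule pmf_map_pos)
      then have "pmf (map_pmf f P) (f \<omega>) \<noteq> 0" "pmf (k (f \<omega>)) (v \<omega>) \<noteq> 0" unfolding pmf_k by auto
      then have "0 < pmf (map_pmf f P) (f \<omega>)" "0 < pmf (k (f \<omega>)) (v \<omega>)" by (simp_all add: pmf_nonneg less_le)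
      then show "log 2 (pmf (map_pmf (\<lambda>\<omega>. (f \<omega>, v \<omega>)) P) (f \<omega>, v \<omega>)) =
        log 2 (pmf (map_pmf f P) (f \<omega>)) + log 2 (pmf (k (f \<omega>)) (v \<omega>))"
        unfolding pmf_k by (simp add: log_mult)
    qed
  qed auto
  also have "\<dots> = log_lik P f + measure_pmf.expectation P (\<lambda>\<omega>. log 2 (pmf (k (f \<omega>)) (v \<omega>)))"
    unfolding log_lik_def by (intro Bochner_Integration.integral_add integrable_measure_pmf_finite fin)
  finally show ?thesis .
qed

text \<open>All three probabilities are positive on the support, so the logarithm splits there, and
  finite support makes each part integrable.\<close>

lemma expectation_log_ratio:
  assumes fin: "finite (set_pmf P)"
  shows "measure_pmf.expectation P (\<lambda>\<omega>. log 2 (pmf (map_pmf h P) (h \<omega>) / (pmf (map_pmf f P) (f \<omega>) * pmf (map_pmf g P) (g \<omega>))))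
    = log_lik P h - log_lik P f - log_lik P g"
proof -
  have "measure_pmf.expectation P (\<lambda>\<omega>. log 2 (pmf (map_pmf h P) (h \<omega>) / (pmf (map_pmf f P) (f \<omega>) * pmf (map_pmf g P) (g \<omega>))))
    = measure_pmf.expectation P (\<lambda>\<omega>. log 2 (pmf (map_pmf h P) (h \<omega>)) - log 2 (pmf (map_pmf f P) (f \<omega>)) - log 2 (pmf (map_pmf g P) (g \<omega>)))"
    by (intro integral_cong_AE)
       (auto simp: AE_measure_pmf_iff log_divide_pos log_mult_pos pmf_map_pos)
  also have "\<dots> = log_lik P h - log_lik P f - log_lik P g"
    unfolding log_lik_def using fin by (simp add: integrable_measure_pmf_finite)
  finally show ?thesis .
qed

section \<open>Information measures as combinations of log-likelihoods\<close>

lemma distributed_pmf: "distributed (measure_pmf P) (count_space UNIV) f (\<lambda>x. ennreal (pmf (map_pmf f P) x))"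
  unfolding distributed_def
  by (simp add: map_pmf_rep_eq[symmetric] measure_pmf_eq_density[symmetric])

lemma integral_count_space_pmf:
  fixes g :: "'a \<Rightarrow> real"
  shows "(\<integral>x. pmf p x * g x \<partial>count_space UNIV) = measure_pmf.expectation p g"
  by (simp add: measure_pmf_eq_density integral_density)

text \<open>The density formula for mutual information is evaluated with respect to counting
  measures. Countability of the types makes the product of two counting measures a counting measure
  again and makes each of them sigma-finite.\<close>

lemma mut_info_log_lik:
  fixes P :: "'w pmf" and A :: "'w \<Rightarrow> 'a::countable" and B :: "'w \<Rightarrow> 'b::countable"
  assumes fin: "finite (set_pmf P)"
  shows "mut_info P A B = log_lik P (\<lambda>\<omega>. (A \<omega>, B \<omega>)) - log_lik P A - log_lik P B" (is ?eq)
    and "0 \<le> mut_info P A B" (is ?nonneg)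
proof -
  interpret information_space "measure_pmf P" 2 by unfold_locales simp
  have pair: "count_space UNIV \<Otimes>\<^sub>M count_space UNIV = count_space (UNIV :: ('a \<times> 'b) set)"
    by (subst pair_measure_countable) auto
  have sf: "sigma_finite_measure (count_space (UNIV :: 'a set))" "sigma_finite_measure (count_space (UNIV :: 'b set))"
    by (auto intro: sigma_finite_measure_count_space_countable)
  let ?pxy = "pmf (map_pmf (\<lambda>\<omega>. (A \<omega>, B \<omega>)) P)"
  let ?g = "\<lambda>x. log 2 (?pxy x / (pmf (map_pmf A P) (fst x) * pmf (map_pmf B P) (snd x)))"
  have dxy: "distributed (measure_pmf P) (count_space UNIV \<Otimes>\<^sub>M count_space UNIV) (\<lambda>\<omega>. (A \<omega>, B \<omega>)) ?pxy"
    unfolding pair by (rule distributed_pmf)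
  have "mut_info P A B = (\<integral>x. ?pxy x * ?g x \<partial>(count_space UNIV \<Otimes>\<^sub>M count_space UNIV))"
    unfolding mut_info_def
    by (rule mutual_information_distr[OF sf distributed_pmf _ distributed_pmf _ dxy]) auto
  also have "\<dots> = measure_pmf.expectation (map_pmf (\<lambda>\<omega>. (A \<omega>, B \<omega>)) P) ?g"
    unfolding pair by (rule integral_count_space_pmf)
  also have "\<dots> = log_lik P (\<lambda>\<omega>. (A \<omega>, B \<omega>)) - log_lik P A - log_lik P B"
    using expectation_log_ratio[OF fin, of "\<lambda>\<omega>. (A \<omega>, B \<omega>)" A B] by simp
  finally show ?eq .
  show ?nonneg
    unfolding mut_info_def
  proof (rule mutual_information_nonneg[OF sf distributed_pmf _ distributed_pmf _ dxy])
    have "integrable (measure_pmf (map_pmf (\<lambda>\<omega>. (A \<omega>, B \<omega>)) P)) ?g"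
      using fin by (intro integrable_measure_pmf_finite) simp
    then show "integrable (count_space UNIV \<Otimes>\<^sub>M count_space UNIV) (\<lambda>x. ?pxy x * ?g x)"
      unfolding pair measure_pmf_eq_density by (subst (asm) integrable_density) auto
  qed auto
qed

text \<open>Conditional mutual information is by definition I(A;B,C) - I(A;C), so the unconditional
  case applies twice and the terms for \<open>A\<close> cancel.\<close>

lemma cond_mut_info_log_lik:
  fixes P :: "'w pmf" and A :: "'w \<Rightarrow> 'a::countable" and B :: "'w \<Rightarrow> 'b::countable" and C :: "'w \<Rightarrow> 'c::countable"
  assumes fin: "finite (set_pmf P)"
  shows "cond_mut_info P A B C = log_lik P (\<lambda>\<omega>. (A \<omega>, B \<omega>, C \<omega>)) - log_lik P (\<lambda>\<omega>. (B \<omega>, C \<omega>))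
    - log_lik P (\<lambda>\<omega>. (A \<omega>, C \<omega>)) + log_lik P C"
proof -
  have pair: "count_space UNIV \<Otimes>\<^sub>M count_space UNIV = count_space (UNIV :: ('b \<times> 'c) set)"
    by (subst pair_measure_countable) auto
  have "cond_mut_info P A B C = mut_info P A (\<lambda>\<omega>. (B \<omega>, C \<omega>)) - mut_info P A C"
    unfolding cond_mut_info_def mut_info_def
    by (simp add: prob_space.conditional_mutual_information_def[OF measure_pmf.prob_space_axioms] pair)
  then show ?thesis by (simp add: mut_info_log_lik[OF fin])
qed

lemma cond_entropy_log_lik:
  fixes P :: "'w pmf" and A :: "'w \<Rightarrow> 'a::countable" and B :: "'w \<Rightarrow> 'b::countable"
  assumes fin: "finite (set_pmf P)"
  shows "cond_entropy P A B = log_lik P B - log_lik P (\<lambda>\<omega>. (A \<omega>, B \<omega>))"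
proof -
  interpret information_space "measure_pmf P" 2 by unfold_locales simp
  have pair: "count_space UNIV \<Otimes>\<^sub>M count_space UNIV = count_space (UNIV :: ('a \<times> 'b) set)"
    by (subst pair_measure_countable) auto
  have sf: "sigma_finite_measure (count_space (UNIV :: 'a set))" "sigma_finite_measure (count_space (UNIV :: 'b set))"
    by (auto intro: sigma_finite_measure_count_space_countable)
  let ?pxy = "pmf (map_pmf (\<lambda>\<omega>. (A \<omega>, B \<omega>)) P)"
  let ?g = "\<lambda>x. log 2 (?pxy x / pmf (map_pmf B P) (snd x))"
  have dxy: "distributed (measure_pmf P) (count_space UNIV \<Otimes>\<^sub>M count_space UNIV) (\<lambda>\<omega>. (A \<omega>, B \<omega>)) ?pxy"
    unfolding pair by (rule distributed_pmf)
  have "cond_entropy P A B = - (\<integral>(x, y). ?pxy (x, y) * log 2 (?pxy (x, y) / pmf (map_pmf B P) y) \<partial>(count_space UNIV \<Otimes>\<^sub>M count_space UNIV))"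
    unfolding cond_entropy_def
    by (rule conditional_entropy_generic_eq[OF sf distributed_pmf _ dxy]) auto
  also have "\<dots> = - measure_pmf.expectation (map_pmf (\<lambda>\<omega>. (A \<omega>, B \<omega>)) P) ?g"
    unfolding pair using integral_count_space_pmf[of "map_pmf (\<lambda>\<omega>. (A \<omega>, B \<omega>)) P" ?g] by (simp add: case_prod_unfold)
  also have "measure_pmf.expectation (map_pmf (\<lambda>\<omega>. (A \<omega>, B \<omega>)) P) ?g
      = measure_pmf.expectation P (\<lambda>\<omega>. log 2 (?pxy (A \<omega>, B \<omega>)) - log 2 (pmf (map_pmf B P) (B \<omega>)))"
    by simp (intro integral_cong_AE, auto simp: AE_measure_pmf_iff log_divide_pos pmf_map_pos[of _ P "\<lambda>\<omega>. (A \<omega>, B \<omega>)"] pmf_map_pos[of _ P B])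
  also have "\<dots> = log_lik P (\<lambda>\<omega>. (A \<omega>, B \<omega>)) - log_lik P B"
    unfolding log_lik_def using fin by (intro Bochner_Integration.integral_diff integrable_measure_pmf_finite)
  finally show ?thesis by simp
qed

text \<open>By the Markov chain, I(V;Y1|Y2,X) is H(V|Y2,X) - H(V|Y1). Hence the branch of
  \<open>rate_12\<close> with the entropy difference equals I(X;Y2,V), the branch with
  \<open>C12\<close> equals \<open>I2 - I0 + C12\<close> in the notation of
  \<open>reliable_first_12\<close>, and the outer minimum supplies the constraint for receiver
  1.\<close>

lemma reliable_rate_12:
  fixes W :: "'x::finite \<Rightarrow> ('y1::finite \<times> 'y2::finite) pmf"
  assumes fin: "\<And>y. finite (set_pmf (qv y))" "\<And>y. finite (set_pmf (qu y))"
    and C: "0 \<le> C12" "0 \<le> C21" and R: "0 \<le> R" and less: "R < rate_12 C12 C21 (joint_pmf W p qu qv)"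
  shows "reliable_codes W C12 C21 (\<lambda>_. R)"
proof -
  define P where "P = joint_pmf W p qu qv"
  define j where "j = single_letter W p qv"
  let ?pi = "\<lambda>(x, y1, y2, u, v). (x, y1, y2, v)"
  let ?X = "\<lambda>(x, y1, y2, v). x" and ?Y1 = "\<lambda>(x, y1, y2, v). y1" and ?Y2 = "\<lambda>(x, y1, y2, v). y2" and ?V = "\<lambda>(x, y1, y2, v). v"
  \<comment> \<open>\<open>single_letter\<close> is the marginal of \<open>joint_pmf\<close> on the
    letters other than \<open>u\<close>, so all quantities in \<open>rate_12\<close> can be computed
    under \<open>j\<close>.\<close>
  have j_P: "map_pmf ?pi P = j"
    by (simp add: P_def j_def joint_pmf_def single_letter_def map_pmf_def bind_assoc_pmf bind_return_pmf
        case_prod_unfold)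
  have finP: "finite (set_pmf P)" unfolding P_def joint_pmf_def by (auto simp: fin)
  have finj: "finite (set_pmf j)" unfolding j_P[symmetric] using finP by simp
  have rv: "rvX = (\<lambda>\<omega>. ?X (?pi \<omega>))" "rvY1 = (\<lambda>\<omega>. ?Y1 (?pi \<omega>))" "rvY2 = (\<lambda>\<omega>. ?Y2 (?pi \<omega>))" "rvV = (\<lambda>\<omega>. ?V (?pi \<omega>))"
    by (auto simp: rvX_def rvY1_def rvY2_def rvV_def)
  have lik: "log_lik P (\<lambda>\<omega>. f (?pi \<omega>)) = log_lik j f" for f :: "_ \<Rightarrow> 'k"
    unfolding j_P[symmetric] log_lik_map ..
  let ?l = "\<lambda>f. log_lik j f"
  have rate: "rate_12 C12 C21 P = min (?l (\<lambda>\<omega>. (?X \<omega>, ?Y1 \<omega>)) - ?l ?X - ?l ?Y1 + C21)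
     (?l (\<lambda>\<omega>. (?X \<omega>, ?Y2 \<omega>)) - ?l ?X - ?l ?Y2
      - (?l (\<lambda>\<omega>. (?V \<omega>, ?Y1 \<omega>, ?Y2 \<omega>, ?X \<omega>)) - ?l (\<lambda>\<omega>. (?Y1 \<omega>, ?Y2 \<omega>, ?X \<omega>)) - ?l (\<lambda>\<omega>. (?V \<omega>, ?Y2 \<omega>, ?X \<omega>)) + ?l (\<lambda>\<omega>. (?Y2 \<omega>, ?X \<omega>)))
      + min C12 ((?l ?Y2 - ?l (\<lambda>\<omega>. (?V \<omega>, ?Y2 \<omega>))) - (?l ?Y1 - ?l (\<lambda>\<omega>. (?V \<omega>, ?Y1 \<omega>)))))"
    unfolding rate_12_def first_link_12_def mut_info_log_lik[OF finP] cond_mut_info_log_lik[OF finP] cond_entropy_log_lik[OF finP]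
    unfolding rv lik[symmetric] ..
  have map_X: "map_pmf ?X j = p"
    by (simp add: j_def single_letter_def map_bind_pmf case_prod_unfold pmf.map_comp o_def bind_return_pmf')
  then have map_fst: "map_pmf fst j = p" by (simp add: case_prod_unfold)
  define \<kappa> where "\<kappa> = measure_pmf.expectation j (\<lambda>\<omega>. log 2 (pmf (qv (?Y1 \<omega>)) (?V \<omega>)))"
  txt \<open>The Markov chain \<open>V - Y1 - (X, Y2)\<close>: both conditional log-likelihoods of \<open>V\<close> equal \<open>\<kappa>\<close>.\<close>
  have k1: "?l (\<lambda>\<omega>. (?Y1 \<omega>, ?V \<omega>)) = ?l ?Y1 + \<kappa>" unfolding \<kappa>_def
    by (rule log_lik_add_kernel[OF finj])
       (simp add: j_def single_letter_def map_bind_pmf bind_map_pmf bind_assoc_pmf bind_return_pmf case_prod_unfold pmf.map_comp o_def)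
  have k2: "?l (\<lambda>\<omega>. ((?Y1 \<omega>, ?Y2 \<omega>, ?X \<omega>), ?V \<omega>)) = ?l (\<lambda>\<omega>. (?Y1 \<omega>, ?Y2 \<omega>, ?X \<omega>)) + \<kappa>"
    using log_lik_add_kernel[OF finj, of "\<lambda>\<omega>. (?Y1 \<omega>, ?Y2 \<omega>, ?X \<omega>)" ?V "\<lambda>(y1, y2, x). qv y1"]
    unfolding \<kappa>_def
    by (simp add: j_def single_letter_def map_bind_pmf bind_map_pmf bind_assoc_pmf bind_return_pmf case_prod_unfold pmf.map_comp o_def)
  \<comment> \<open>Entropy is invariant under relabelling. Bringing each tuple to one order makes
    equal terms syntactically equal for the final arithmetic.\<close>
  have swaps: "?l (\<lambda>\<omega>. (?V \<omega>, ?Y1 \<omega>)) = ?l (\<lambda>\<omega>. (?Y1 \<omega>, ?V \<omega>))"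
    "?l (\<lambda>\<omega>. (?V \<omega>, ?Y2 \<omega>)) = ?l (\<lambda>\<omega>. (?Y2 \<omega>, ?V \<omega>))"
    "?l (\<lambda>\<omega>. (?Y2 \<omega>, ?X \<omega>)) = ?l (\<lambda>\<omega>. (?X \<omega>, ?Y2 \<omega>))"
    "?l (\<lambda>\<omega>. (?V \<omega>, ?Y1 \<omega>, ?Y2 \<omega>, ?X \<omega>)) = ?l (\<lambda>\<omega>. ((?Y1 \<omega>, ?Y2 \<omega>, ?X \<omega>), ?V \<omega>))"
    "?l (\<lambda>\<omega>. (?V \<omega>, ?Y2 \<omega>, ?X \<omega>)) = ?l (\<lambda>\<omega>. (?X \<omega>, ?Y2 \<omega>, ?V \<omega>))"
    "?l (\<lambda>\<omega>. ((?X \<omega>, ?V \<omega>), ?Y2 \<omega>)) = ?l (\<lambda>\<omega>. (?X \<omega>, ?Y2 \<omega>, ?V \<omega>))"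
    using log_lik_inj[of prod.swap j "\<lambda>\<omega>. (?Y1 \<omega>, ?V \<omega>)"] log_lik_inj[of prod.swap j "\<lambda>\<omega>. (?Y2 \<omega>, ?V \<omega>)"]
      log_lik_inj[of prod.swap j "\<lambda>\<omega>. (?X \<omega>, ?Y2 \<omega>)"] log_lik_inj[of prod.swap j "\<lambda>\<omega>. ((?Y1 \<omega>, ?Y2 \<omega>, ?X \<omega>), ?V \<omega>)"]
      log_lik_inj[of "\<lambda>(x, y2, v). (v, y2, x)" j "\<lambda>\<omega>. (?X \<omega>, ?Y2 \<omega>, ?V \<omega>)"]
      log_lik_inj[of "\<lambda>(x, y2, v). ((x, v), y2)" j "\<lambda>\<omega>. (?X \<omega>, ?Y2 \<omega>, ?V \<omega>)"]
    by (simp_all add: inj_on_def case_prod_unfold prod_eq_iff prod.swap_def)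
  define pv where "pv = map_pmf ?V j"
  have I0: "measure_pmf.expectation j (\<lambda>(x, y1, y2, v). log 2 (pmf (qv y1) v / pmf pv v)) = \<kappa> - ?l ?V"
  proof -
    have "measure_pmf.expectation j (\<lambda>(x, y1, y2, v). log 2 (pmf (qv y1) v / pmf pv v))
      = measure_pmf.expectation j (\<lambda>\<omega>. log 2 (pmf (qv (?Y1 \<omega>)) (?V \<omega>)) - log 2 (pmf pv (?V \<omega>)))"
    proof (intro integral_cong_AE)
      have "log 2 (pmf (qv y1) v / pmf pv v) = log 2 (pmf (qv y1) v) - log 2 (pmf pv v)"
        if z: "(x, y1, y2, v) \<in> set_pmf j" for x y1 y2 v
      proof -
        have "0 < pmf (qv y1) v" using z by (auto simp: j_def set_single_letter intro: pmf_positive)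
        moreover have "0 < pmf pv v" using pmf_map_pos[OF z, of ?V] by (simp add: pv_def)
        ultimately show ?thesis by (simp add: log_divide_pos)
      qed
      then show "AE \<omega> in measure_pmf j. (case \<omega> of (x, y1, y2, v) \<Rightarrow> log 2 (pmf (qv y1) v / pmf pv v))
          = log 2 (pmf (qv (?Y1 \<omega>)) (?V \<omega>)) - log 2 (pmf pv (?V \<omega>))"
        by (auto simp: AE_measure_pmf_iff)
    qed auto
    then show ?thesis
      unfolding \<kappa>_def log_lik_def pv_def[symmetric] using finj by (simp add: integrable_measure_pmf_finite)
  qed
  have I1: "measure_pmf.expectation j (\<lambda>(x, y1, y2, v). log 2 (dens_ratio p (map_pmf (\<lambda>(x, y1, y2, v). (x, y2, v)) j) x (y2, v)))
     = ?l (\<lambda>\<omega>. (?X \<omega>, ?Y2 \<omega>, ?V \<omega>)) - ?l ?X - ?l (\<lambda>\<omega>. (?Y2 \<omega>, ?V \<omega>))"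
    using expectation_log_ratio[OF finj, of "\<lambda>\<omega>. (?X \<omega>, ?Y2 \<omega>, ?V \<omega>)" ?X "\<lambda>\<omega>. (?Y2 \<omega>, ?V \<omega>)"]
    by (simp add: map_fst dens_ratio_def case_prod_unfold pmf.map_comp o_def)
  have I2: "measure_pmf.expectation j (\<lambda>(x, y1, y2, v). log 2 (dens_ratio (pair_pmf p pv) (map_pmf (\<lambda>(x, y1, y2, v). ((x, v), y2)) j) (x, v) y2))
     = ?l (\<lambda>\<omega>. (?X \<omega>, ?Y2 \<omega>, ?V \<omega>)) - ?l ?X - ?l ?V - ?l ?Y2"
  proof -
    let ?h = "\<lambda>\<omega>. ((?X \<omega>, ?V \<omega>), ?Y2 \<omega>)"
    have "measure_pmf.expectation j (\<lambda>(x, y1, y2, v). log 2 (dens_ratio (pair_pmf p pv) (map_pmf (\<lambda>(x, y1, y2, v). ((x, v), y2)) j) (x, v) y2))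
      = measure_pmf.expectation j (\<lambda>\<omega>. log 2 (pmf (map_pmf ?h j) (?h \<omega>)) - log 2 (pmf (map_pmf ?X j) (?X \<omega>))
          - log 2 (pmf (map_pmf ?V j) (?V \<omega>)) - log 2 (pmf (map_pmf ?Y2 j) (?Y2 \<omega>)))"
    proof (intro integral_cong_AE)
      have "log 2 (dens_ratio (pair_pmf p pv) (map_pmf (\<lambda>(x, y1, y2, v). ((x, v), y2)) j) (x, v) y2)
        = log 2 (pmf (map_pmf ?h j) ((x, v), y2)) - log 2 (pmf (map_pmf ?X j) x) - log 2 (pmf (map_pmf ?V j) v) - log 2 (pmf (map_pmf ?Y2 j) y2)"
        if z: "(x, y1, y2, v) \<in> set_pmf j" for x y1 y2 v
      proof -
        have "0 < pmf (map_pmf ?h j) ((x, v), y2)" "0 < pmf (map_pmf ?X j) x" "0 < pmf (map_pmf ?V j) v" "0 < pmf (map_pmf ?Y2 j) y2"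
          using pmf_map_pos[OF z, of ?h] pmf_map_pos[OF z, of ?X] pmf_map_pos[OF z, of ?V] pmf_map_pos[OF z, of ?Y2] by simp_all
        moreover have "dens_ratio (pair_pmf p pv) (map_pmf (\<lambda>(x, y1, y2, v). ((x, v), y2)) j) (x, v) y2
          = pmf (map_pmf ?h j) ((x, v), y2) / (pmf (map_pmf ?X j) x * pmf (map_pmf ?V j) v * pmf (map_pmf ?Y2 j) y2)"
          unfolding dens_ratio_def pmf_pair pv_def map_X by (simp add: pmf.map_comp o_def case_prod_unfold)
        ultimately show ?thesis by (simp add: log_divide_pos log_mult_pos)
      qed
      then show "AE \<omega> in measure_pmf j. (case \<omega> of (x, y1, y2, v) \<Rightarrow>
          log 2 (dens_ratio (pair_pmf p pv) (map_pmf (\<lambda>(x, y1, y2, v). ((x, v), y2)) j) (x, v) y2))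
        = log 2 (pmf (map_pmf ?h j) (?h \<omega>)) - log 2 (pmf (map_pmf ?X j) (?X \<omega>))
          - log 2 (pmf (map_pmf ?V j) (?V \<omega>)) - log 2 (pmf (map_pmf ?Y2 j) (?Y2 \<omega>))"
        by (auto simp: AE_measure_pmf_iff)
    qed auto
    also have "\<dots> = ?l ?h - ?l ?X - ?l ?V - ?l ?Y2"
      unfolding log_lik_def using finj by (simp add: integrable_measure_pmf_finite)
    finally show ?thesis by (simp only: swaps)
  qed
  have I3: "measure_pmf.expectation j (\<lambda>(x, y1, y2, v). log 2 (dens_ratio p (map_pmf (\<lambda>(x, y1, y2, v). (x, y1)) j) x y1))
     = ?l (\<lambda>\<omega>. (?X \<omega>, ?Y1 \<omega>)) - ?l ?X - ?l ?Y1"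
    using expectation_log_ratio[OF finj, of "\<lambda>\<omega>. (?X \<omega>, ?Y1 \<omega>)" ?X ?Y1]
    by (simp add: map_fst dens_ratio_def case_prod_unfold pmf.map_comp o_def)
  \<comment> \<open>\<open>\<kappa> - ?l ?V\<close> is I(Y1;V), hence nonnegative; this supplies the
    assumption \<open>0 \<le> I0\<close>.\<close>
  have "0 \<le> mut_info j ?Y1 ?V" by (rule mut_info_log_lik(2)[OF finj])
  then have nonneg: "0 \<le> \<kappa> - ?l ?V" by (simp add: mut_info_log_lik(1)[OF finj] k1)
  show ?thesis
    by (rule reliable_first_12[where q = qv and p = p and W = W, OF fin(1) C R, folded j_def, folded pv_def, unfolded I0 I1 I2 I3])
       (use nonneg less in \<open>auto simp: P_def[symmetric] rate swaps k1 k2 min_def split: if_splits\<close>)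
qed

section \<open>The reversed order and the boundary of the region\<close>

fun swap_conference :: "('y2, 'y1) conference \<Rightarrow> ('y1, 'y2) conference" where
  "swap_conference (First12 h k) = First21 h k"
| "swap_conference (First21 h k) = First12 h k"

lemma exchange_swap: "exchange (swap_conference c) y1 y2 = prod.swap (exchange c y2 y1)"
  by (cases c) auto

lemma is_conference_swap: "is_conference n R12 R21 (swap_conference c) \<longleftrightarrow> is_conference n R21 R12 c"
  by (cases c) auto

definition swap_code :: "('x, 'y2, 'y1) code \<Rightarrow> ('x, 'y1, 'y2) code" where
  "swap_code c = \<lparr>encoder = encoder c, conf = swap_conference (conf c), decoder1 = decoder2 c, decoder2 = decoder1 c\<rparr>"

lemma is_code_swap: "is_code C21 C12 n R c \<Longrightarrow> is_code C12 C21 n R (swap_code c)"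
  by (auto simp: is_code_def swap_code_def is_conference_swap)

lemma channel_block_swap:
  "channel_block (\<lambda>x. map_pmf prod.swap (W x)) n x = map_pmf prod.swap (channel_block W n x)"
proof -
  \<comment> \<open>Outside \<open>{..<n}\<close> the swapped words carry
    \<open>prod.swap undefined\<close> instead of \<open>undefined\<close>. The default is changed
    first, and the restriction in \<open>channel_block\<close> erases what remains.\<close>
  have "Pi_pmf {..<n} undefined (\<lambda>i. map_pmf prod.swap (W (x i)))
     = map_pmf (\<lambda>f i. if i \<in> {..<n} then f i else undefined) (Pi_pmf {..<n} (prod.swap undefined) (\<lambda>i. map_pmf prod.swap (W (x i))))"
    by (rule Pi_pmf_default_swap[symmetric]) simp
  also have "Pi_pmf {..<n} (prod.swap undefined) (\<lambda>i. map_pmf prod.swap (W (x i)))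
     = map_pmf (\<lambda>h. prod.swap \<circ> h) (Pi_pmf {..<n} undefined (\<lambda>i. W (x i)))"
    by (rule Pi_pmf_map) auto
  finally show ?thesis
    by (simp add: channel_block_def pmf.map_comp o_def restrict_def cong: if_cong)
qed

lemma error_prob_swap:
  "error_prob W n R (swap_code c) = error_prob (\<lambda>x. map_pmf prod.swap (W x)) n R c"
proof -
  have "error_prob (\<lambda>x. map_pmf prod.swap (W x)) n R c = measure_pmf.prob
       (map_pmf (\<lambda>(w, y1, y2). (w, y2, y1)) (bind_pmf (pmf_of_set (messages n R)) (\<lambda>w.
          map_pmf (\<lambda>(y1, y2). (w, y1, y2)) (channel_block W n (encoder c w)))))
       {(w, y1, y2). decoder1 c (snd (exchange (conf c) y1 y2)) y1 \<noteq> w \<or>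
                     decoder2 c (fst (exchange (conf c) y1 y2)) y2 \<noteq> w}"
    unfolding error_prob_def channel_block_swap
    by (simp add: map_bind_pmf pmf.map_comp o_def case_prod_unfold prod.swap_def)
  also have "\<dots> = error_prob W n R (swap_code c)"
    unfolding error_prob_def prob_map_pmf swap_code_def
    by (auto simp: exchange_swap intro!: arg_cong[where f = "measure_pmf.prob _"])
  finally show ?thesis ..
qed

lemma reliable_codes_swap:
  assumes "reliable_codes (\<lambda>x. map_pmf prod.swap (W x)) C21 C12 r"
  shows "reliable_codes W C12 C21 r"
proof -
  from assms obtain c where c: "\<And>n. is_code C21 C12 n (r n) (c n)"
    "(\<lambda>n. error_prob (\<lambda>x. map_pmf prod.swap (W x)) n (r n) (c n)) \<longlonglongrightarrow> 0"
    by (auto simp: reliable_codes_def)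
  then show ?thesis
    unfolding reliable_codes_def by (intro exI[of _ "\<lambda>n. swap_code (c n)"]) (simp add: is_code_swap error_prob_swap)
qed

lemma joint_pmf_swap:
  "joint_pmf (\<lambda>x. map_pmf prod.swap (W x)) p qv qu
    = map_pmf (\<lambda>(x, y1, y2, u, v). (x, y2, y1, v, u)) (joint_pmf W p qu qv)"
proof -
  have "joint_pmf (\<lambda>x. map_pmf prod.swap (W x)) p qv qu = bind_pmf p (\<lambda>x. bind_pmf (W x) (\<lambda>y.
      bind_pmf (qv (fst y)) (\<lambda>v. bind_pmf (qu (snd y)) (\<lambda>u. return_pmf (x, snd y, fst y, v, u)))))"
    by (simp add: joint_pmf_def bind_map_pmf case_prod_unfold)
  also have "\<dots> = bind_pmf p (\<lambda>x. bind_pmf (W x) (\<lambda>y.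
      bind_pmf (qu (snd y)) (\<lambda>u. bind_pmf (qv (fst y)) (\<lambda>v. return_pmf (x, snd y, fst y, v, u)))))"
    by (rule bind_pmf_cong[OF refl], rule bind_pmf_cong[OF refl], rule bind_commute_pmf)
  also have "\<dots> = map_pmf (\<lambda>(x, y1, y2, u, v). (x, y2, y1, v, u)) (joint_pmf W p qu qv)"
    by (simp add: joint_pmf_def map_bind_pmf case_prod_unfold)
  finally show ?thesis .
qed

text \<open>The two rates are mirror images, but their information measures live on differently
  ordered letters. \<open>log_lik_map\<close> transports both to the same law, where they
  coincide.\<close>

lemma rate_21_swap:
  fixes P :: "('x::finite, 'y1::finite, 'y2::finite) letters pmf"
  assumes fin: "finite (set_pmf P)"
  shows "rate_21 C12 C21 P = rate_12 C21 C12 (map_pmf (\<lambda>(x, y1, y2, u, v). (x, y2, y1, v, u)) P)"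
proof -
  have finm: "finite (set_pmf (map_pmf (\<lambda>(x, y1, y2, u, v). (x, y2, y1, v, u)) P))" using fin by simp
  show ?thesis
    unfolding rate_21_def rate_12_def first_link_12_def first_link_21_def
      mut_info_log_lik[OF fin] cond_mut_info_log_lik[OF fin] cond_entropy_log_lik[OF fin]
      mut_info_log_lik[OF finm] cond_mut_info_log_lik[OF finm] cond_entropy_log_lik[OF finm] log_lik_map
    by (simp add: rvX_def rvY1_def rvY2_def rvU_def rvV_def case_prod_unfold)
qed

lemma finite_set_test_channel: "q \<in> test_channels \<Longrightarrow> finite (set_pmf (q a))"
  by (auto simp: test_channels_def intro: finite_subset)

text \<open>Strictly below a supremum, some single choice of distributions already exceeds
  \<open>R\<close>. A real \<open>R\<close> is never below the value for excluded terms, so the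
  winning term is one of the two rates; the second is reduced to the first by exchanging the
  receivers.\<close>

lemma achievable_below_rate_bound:
  assumes C: "0 \<le> C12" "0 \<le> C21" and R: "0 \<le> R" and less: "ereal R < rate_bound W C12 C21"
  shows "achievable W C12 C21 R"
proof -
  from less obtain p qu qv where q: "qu \<in> test_channels" "qv \<in> test_channels"
    and *: "ereal R < admitted_rate C12 C21 (joint_pmf W p qu qv)"
    by (auto simp: rate_bound_def less_SUP_iff)
  note fin = finite_set_test_channel[OF q(1)] finite_set_test_channel[OF q(2)]
  have finP: "finite (set_pmf (joint_pmf W p qu qv))" by (auto simp: joint_pmf_def fin)
  from * consider "R < rate_12 C12 C21 (joint_pmf W p qu qv)" | "R < rate_21 C12 C21 (joint_pmf W p qu qv)"
    by (auto simp: admitted_rate_def less_max_iff_disj split: if_splits)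
  then show ?thesis
  proof cases
    case 1
    then show ?thesis unfolding achievable_def by (rule reliable_rate_12[OF fin(2,1) C R])
  next
    case 2
    then have "R < rate_12 C21 C12 (joint_pmf (\<lambda>x. map_pmf prod.swap (W x)) p qv qu)"
      by (simp only: rate_21_swap[OF finP] joint_pmf_swap)
    then show ?thesis
      unfolding achievable_def by (rule reliable_codes_swap[OF reliable_rate_12[OF fin(1,2) C(2,1) R]])
  qed
qed

section \<open>Rate zero and the boundary of the region\<close>

lemma reliable_codes_0:
  fixes W :: "'x \<Rightarrow> ('y1 \<times> 'y2) pmf"
  assumes "0 \<le> C12" "0 \<le> C21"
  shows "reliable_codes W C12 C21 (\<lambda>_. 0)"
proof -
  define c :: "nat \<Rightarrow> ('x, 'y1, 'y2) code" where "c n = \<lparr>encoder = (\<lambda>_. restrict (\<lambda>_. undefined) {..<n}), conf = First12 (\<lambda>_. 1) (\<lambda>_ _. 1),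
    decoder1 = (\<lambda>_ _. 1), decoder2 = (\<lambda>_ _. 1)\<rparr>" for n :: nat
  have m: "messages n 0 = {1}" for n by (simp add: messages_def)
  have "is_code C12 C21 n 0 (c n)" for n
    unfolding is_code_def by (intro conjI exI[of _ 0]) (auto simp: assms c_def m words_def)
  moreover have "error_prob W n 0 (c n) = 0" for n
    unfolding error_prob_def
    by (subst measure_pmf_zero_iff) (auto simp: m c_def)
  ultimately show ?thesis unfolding reliable_codes_def by (intro exI[of _ c]) auto
qed

lemma diagonal_tendsto_0:
  fixes e :: "nat \<Rightarrow> nat \<Rightarrow> real"
  assumes "\<And>k. e k \<longlonglongrightarrow> 0"
  obtains \<kappa> where "filterlim \<kappa> at_top sequentially" "(\<lambda>n. e (\<kappa> n) n) \<longlonglongrightarrow> 0"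
proof -
  define G where "G n = {k. k \<le> n \<and> (k = 0 \<or> \<bar>e k n\<bar> \<le> 1 / real (Suc k) )}" for n
  define \<kappa> where "\<kappa> n = Max (G n)" for n
  have finG: "finite (G n)" and neG: "G n \<noteq> {}" for n
    by (auto simp: G_def)
  have \<kappa>_in: "\<kappa> n \<in> G n" for n unfolding \<kappa>_def using finG neG by (rule Max_in)
  have top: "\<forall>\<^sub>F n in sequentially. K \<le> \<kappa> n" for K
  proof -
    have "\<forall>\<^sub>F n in sequentially. \<bar>e K n\<bar> < 1 / real (Suc K)"
      using tendsto_rabs_zero[OF assms] by (rule order_tendstoD) simp
    then show ?thesis using eventually_ge_at_top[of K]
    proof eventually_elim
      case (elim n)
      then have "K \<in> G n" by (simp add: G_def)
      then show ?case unfolding \<kappa>_def using finG by (rule Max_ge[rotated])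
    qed
  qed
  then have lim: "filterlim \<kappa> at_top sequentially" by (simp add: filterlim_at_top)
  moreover have "(\<lambda>n. e (\<kappa> n) n) \<longlonglongrightarrow> 0"
  proof (rule Lim_null_comparison)
    \<comment> \<open>Once the index is at least 1, the exemption for 0 is out of reach and
      membership in \<open>G n\<close> gives the bound.\<close>
    show "\<forall>\<^sub>F n in sequentially. norm (e (\<kappa> n) n) \<le> 1 / real (Suc (\<kappa> n))"
      using top[of 1]
    proof eventually_elim
      case (elim n)
      then show ?case using \<kappa>_in[of n] by (simp add: G_def)
    qed
    show "(\<lambda>n. 1 / real (Suc (\<kappa> n))) \<longlonglongrightarrow> 0"
      by (rule filterlim_compose[OF _ lim, of "\<lambda>k. 1 / real (Suc k)"]) real_asymp
  qed
  ultimately show thesis by (rule that)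
qed

text \<open>Code sequences for rates increasing to \<open>R\<close> are combined along a diagonal
  that moves to the next rate only after its error has become small.\<close>

lemma achievable_limit_from_below:
  assumes R: "0 < R" and below: "\<And>r. 0 \<le> r \<Longrightarrow> r < R \<Longrightarrow> achievable W C12 C21 r"
  shows "achievable_limit W C12 C21 R"
proof -
  \<comment> \<open>These rates start at 0, stay strictly below \<open>R\<close> and increase to
    \<open>R\<close>, so the assumption applies to each of them.\<close>
  define \<rho> where "\<rho> k = R * (1 - 1 / real (Suc k))" for k
  have "0 \<le> \<rho> k" "\<rho> k < R" for k
    using R by (auto simp: \<rho>_def)
  then have "\<exists>c. (\<forall>n. is_code C12 C21 n (\<rho> k) (c n)) \<and> (\<lambda>n. error_prob W n (\<rho> k) (c n)) \<longlonglongrightarrow> 0" for k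
    using below[of "\<rho> k"] by (simp add: achievable_def reliable_codes_def)
  then obtain c where c: "\<And>k n. is_code C12 C21 n (\<rho> k) (c k n)"
    and err: "\<And>k. (\<lambda>n. error_prob W n (\<rho> k) (c k n)) \<longlonglongrightarrow> 0" by metis
  from diagonal_tendsto_0[OF err] obtain \<kappa> where \<kappa>: "filterlim \<kappa> at_top sequentially"
    "(\<lambda>n. error_prob W n (\<rho> (\<kappa> n)) (c (\<kappa> n) n)) \<longlonglongrightarrow> 0" .
  have "\<rho> \<longlonglongrightarrow> R" unfolding \<rho>_def by real_asymp
  from filterlim_compose[OF this \<kappa>(1)] have "(\<lambda>n. \<rho> (\<kappa> n)) \<longlonglongrightarrow> R" .
  moreover have "reliable_codes W C12 C21 (\<lambda>n. \<rho> (\<kappa> n))"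
    unfolding reliable_codes_def using c \<kappa>(2) by (intro exI[of _ "\<lambda>n. c (\<kappa> n) n"]) auto
  ultimately show ?thesis unfolding achievable_limit_def by blast
qed

theorem theorem4:
  fixes W :: "'x::finite \<Rightarrow> ('y1::finite \<times> 'y2::finite) pmf"
    and C12 C21 R :: real
  assumes "0 \<le> C12" and "0 \<le> C21" and "0 \<le> R"
    and "ereal R \<le> rate_bound W C12 C21"
  shows "achievable_limit W C12 C21 R \<and>
         (ereal R < rate_bound W C12 C21 \<longrightarrow> achievable W C12 C21 R)"
proof
  show "achievable_limit W C12 C21 R"
  proof (cases "R = 0")
    case True
    then show ?thesis
      unfolding achievable_limit_def using reliable_codes_0[OF assms(1,2), of W] by (intro exI[of _ "\<lambda>_. 0"]) auto
  next
    case False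
    with assms(3) have "0 < R" by simp
    then show ?thesis
    proof (rule achievable_limit_from_below)
      fix r assume "0 \<le> r" "r < R"
      then have "ereal r < ereal R" by simp
      with assms(4) have "ereal r < rate_bound W C12 C21" by (rule less_le_trans[rotated])
      then show "achievable W C12 C21 r"
        using assms(1,2) \<open>0 \<le> r\<close> by (intro achievable_below_rate_bound)
    qed
  qed
  show "ereal R < rate_bound W C12 C21 \<longrightarrow> achievable W C12 C21 R"
    using assms(1-3) by (blast intro: achievable_below_rate_bound)
qed

end
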